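(* Let $b$ be a locally finite graph over a discrete measure space $(X,m)$ that satisfies the ellipticity condition (EC), i.e. there is a constant $C>0$ such that $b(x,y)\le C\,m(x)m(y)$ for all $x,y\in X$, and that satisfies $CD(0,\infty)$. If the graph is stochastically complete and satisfies the Feller property, then the graph is complete.
   Context: $X$ is a countable discrete set and $m:X\to(0,\infty)$, extended to a measure by $m(A)=\sum_{x\in A}m(x)$; $(X,m)$ is called a discrete measure space. A locally finite graph over $(X,m)$ is a symmetric function $b:X\times X\to[0,\infty)$ with zero diagonal such that $\{y\in X: b(x,y)>0\}$ is finite for every $x\in X$. $C(X)$ denotes all real-valued functions on $X$ and $C_c(X)$ the finitely supported ones. The Laplacian on $C(X)$ is $\Delta f(x)=\frac{1}{m(x)}\sum_{y\in X}b(x,y)(f(y)-f(x))$. Set $\Gamma_0(f,g)=fg$ and iteratively $2\Gamma_{k+1}(f,g)=\Delta\Gamma_k(f,g)-\Gamma_k(f,\Delta g)-\Gamma_k(\Delta f,g)$ for $f,g\in C(X)$, $k\ge 0$; write $\Gamma_k(f)=\Gamma_k(f,f)$ and $\Gamma=\Gamma_1$. The graph satisfies $CD(K,\infty)$, $K\in\mathbb{R}$, if $\Gamma_2(f)\ge K\,\Gamma(f)$ pointwise on $X$ for all $f\in C(X)$. $L$ denotes the Friedrichs extension in $\ell^2(X,m)$ of the symmetric positive operator $-\Delta|_{C_c(X)}$, and $P_t=e^{-tL}$, $t\ge0$, is the heat semigroup. It extends to a positive contraction semigroup on every $\ell^p(X,m)$, $p\in[1,\infty]$, given by $P_tf(x)=\sum_{y\in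 X}p_t(x,y)f(y)m(y)$ with $p_t(x,y)=(P_t1_y)(x)/m(y)$, where $1_y$ is the characteristic function of $\{y\}$. The graph has the Feller property if $P_tC_0(X)\subseteq C_0(X)$ for all $t\ge 0$, where $C_0(X)$ is the closure of $C_c(X)$ with respect to $\|\cdot\|_\infty$. It is stochastically complete if $P_t1=1$ for all $t\ge0$, where $1$ is the constant function. It is complete if there is an increasing sequence of nonnegative functions $\eta_k\in C_c(X)$, $k\in\mathbb{N}$, with $\eta_k\to1$ pointwise and $\Gamma(\eta_k)\to0$ uniformly on $X$, i.e. $\|\Gamma(\eta_k)\|_\infty\to0$, as $k\to\infty$. *)

theory Defs
  imports "HOL-Analysis.Analysis"
begin

section \<open>Graphs over discrete measure spaces\<close>

text \<open>The countable vertex set \<open>X\<close> is the universe of a type of class \<^class>\<open>countable\<close>, so that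
  \<open>C(X)\<close> is the type of all real-valued functions on it.\<close>

definition discrete_measure :: "('a::countable \<Rightarrow> real) \<Rightarrow> bool" where
  "discrete_measure m \<longleftrightarrow> (\<forall>x. 0 < m x)"

definition locally_finite_graph :: "('a::countable \<Rightarrow> 'a \<Rightarrow> real) \<Rightarrow> bool" where
  "locally_finite_graph b \<longleftrightarrow>
     (\<forall>x y. 0 \<le> b x y) \<and> (\<forall>x y. b x y = b y x) \<and> (\<forall>x. b x x = 0) \<and>
     (\<forall>x. finite {y. 0 < b x y})"

definition elliptic :: "('a::countable \<Rightarrow> 'a \<Rightarrow> real) \<Rightarrow> ('a \<Rightarrow> real) \<Rightarrow> bool" where
  "elliptic b m \<longleftrightarrow> (\<exists>C>0. \<forall>x y. b x y \<le> C * m x * m y)"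

definition Cc :: "('a::countable \<Rightarrow> real) set" where
  "Cc = {f. finite {x. f x \<noteq> 0}}"

text \<open>The closure of \<open>Cc\<close> with respect to the supremum norm.\<close>

definition C0 :: "('a::countable \<Rightarrow> real) set" where
  "C0 = {f. \<forall>\<epsilon>>0. \<exists>\<phi>\<in>Cc. \<forall>x. \<bar>f x - \<phi> x\<bar> \<le> \<epsilon>}"

text \<open>The sum ranges over the neighbours of \<open>x\<close> only: all other summands vanish, and
  \<^const>\<open>sum\<close> over an infinite index set would be \<open>0\<close>.\<close>

definition laplacian ::
    "('a::countable \<Rightarrow> 'a \<Rightarrow> real) \<Rightarrow> ('a \<Rightarrow> real) \<Rightarrow> ('a \<Rightarrow> real) \<Rightarrow> 'a \<Rightarrow> real" where
  "laplacian b m f x = 1 / m x * (\<Sum>y | 0 < b x y. b x y * (f y - f x))"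

primrec Gam ::
    "('a::countable \<Rightarrow> 'a \<Rightarrow> real) \<Rightarrow> ('a \<Rightarrow> real) \<Rightarrow> nat \<Rightarrow>
     ('a \<Rightarrow> real) \<Rightarrow> ('a \<Rightarrow> real) \<Rightarrow> 'a \<Rightarrow> real" where
  "Gam b m 0 = (\<lambda>f g x. f x * g x)"
| "Gam b m (Suc k) = (\<lambda>f g x.
     (laplacian b m (Gam b m k f g) x
       - Gam b m k f (laplacian b m g) x
       - Gam b m k (laplacian b m f) g x) / 2)"

text \<open>The curvature dimension condition \<open>CD(K,\<infinity>)\<close>.\<close>

definition CD_inf :: "('a::countable \<Rightarrow> 'a \<Rightarrow> real) \<Rightarrow> ('a \<Rightarrow> real) \<Rightarrow> real \<Rightarrow> bool" where
  "CD_inf b m K \<longleftrightarrow> (\<forall>f x. Gam b m 2 f f x \<ge> K * Gam b m 1 f f x)"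

definition complete_graph :: "('a::countable \<Rightarrow> 'a \<Rightarrow> real) \<Rightarrow> ('a \<Rightarrow> real) \<Rightarrow> bool" where
  "complete_graph b m \<longleftrightarrow>
     (\<exists>\<eta> :: nat \<Rightarrow> 'a \<Rightarrow> real.
        incseq \<eta> \<and> (\<forall>k. \<eta> k \<in> Cc) \<and> (\<forall>k x. 0 \<le> \<eta> k x) \<and>
        (\<forall>x. (\<lambda>k. \<eta> k x) \<longlonglongrightarrow> 1) \<and>
        uniform_limit UNIV (\<lambda>k. Gam b m 1 (\<eta> k) (\<eta> k)) (\<lambda>_. 0) sequentially)"


section \<open>The Friedrichs extension\<close>

definition l2 :: "('a::countable \<Rightarrow> real) \<Rightarrow> ('a \<Rightarrow> real) set" where
  "l2 m = {f. (\<lambda>x. (f x)\<^sup>2 * m x) summable_on UNIV}"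

definition l2_inner :: "('a::countable \<Rightarrow> real) \<Rightarrow> ('a \<Rightarrow> real) \<Rightarrow> ('a \<Rightarrow> real) \<Rightarrow> real" where
  "l2_inner m f g = (\<Sum>\<^sub>\<infinity>x. f x * g x * m x)"

definition l2_norm :: "('a::countable \<Rightarrow> real) \<Rightarrow> ('a \<Rightarrow> real) \<Rightarrow> real" where
  "l2_norm m f = sqrt (l2_inner m f f)"

text \<open>Operators in \<open>l2 m\<close> that need not be everywhere defined are represented by their graphs,
  i.e. sets of pairs \<open>(f, A f)\<close> with \<open>f\<close> in the domain. A densely defined, symmetric, positive
  operator to be extended is given by its domain \<open>D\<close> and a function \<open>A\<close>; its quadratic form is
  \<open>q(f,g) = \<langle>A f, g\<rangle>\<close> on \<open>D\<close>.

  \<open>form_converges m D A \<phi> f\<close>: the sequence \<open>\<phi>\<close> in \<open>D\<close> is Cauchy for \<open>q\<close> and converges to \<open>f\<close>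
  in \<open>l2 m\<close>. The functions \<open>f\<close> admitting such a sequence form the domain of the closure of
  \<open>q\<close>, whose value at \<open>(f,h)\<close> is the limit of \<open>q(\<phi>\<^sub>n,\<psi>\<^sub>n)\<close> for any \<open>\<phi>\<close>, \<open>\<psi>\<close> converging
  to \<open>f\<close>, \<open>h\<close> in this sense.\<close>

definition form_converges ::
    "('a::countable \<Rightarrow> real) \<Rightarrow> ('a \<Rightarrow> real) set \<Rightarrow> (('a \<Rightarrow> real) \<Rightarrow> 'a \<Rightarrow> real) \<Rightarrow>
     (nat \<Rightarrow> 'a \<Rightarrow> real) \<Rightarrow> ('a \<Rightarrow> real) \<Rightarrow> bool" where
  "form_converges m D A \<phi> f \<longleftrightarrow>
     f \<in> l2 m \<and> (\<forall>n. \<phi> n \<in> D) \<and>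
     (\<lambda>n. l2_norm m (\<lambda>x. \<phi> n x - f x)) \<longlonglongrightarrow> 0 \<and>
     (\<forall>\<epsilon>>0. \<exists>N. \<forall>i\<ge>N. \<forall>j\<ge>N.
        l2_inner m (A (\<lambda>x. \<phi> i x - \<phi> j x)) (\<lambda>x. \<phi> i x - \<phi> j x) < \<epsilon>)"

definition form_domain ::
    "('a::countable \<Rightarrow> real) \<Rightarrow> ('a \<Rightarrow> real) set \<Rightarrow> (('a \<Rightarrow> real) \<Rightarrow> 'a \<Rightarrow> real) \<Rightarrow>
     ('a \<Rightarrow> real) set" where
  "form_domain m D A = {f. \<exists>\<phi>. form_converges m D A \<phi> f}"

text \<open>The operator of the closure of \<open>q\<close>: it maps \<open>f\<close> in the form domain to \<open>g\<close> in \<open>l2 m\<close> if the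
  value of the closed form at \<open>(f,h)\<close> is \<open>\<langle>g, h\<rangle>\<close> for all \<open>h\<close> in the form domain.\<close>

definition friedrichs_extension ::
    "('a::countable \<Rightarrow> real) \<Rightarrow> ('a \<Rightarrow> real) set \<Rightarrow> (('a \<Rightarrow> real) \<Rightarrow> 'a \<Rightarrow> real) \<Rightarrow>
     (('a \<Rightarrow> real) \<times> ('a \<Rightarrow> real)) set" where
  "friedrichs_extension m D A =
     {(f, g). f \<in> form_domain m D A \<and> g \<in> l2 m \<and>
        (\<forall>h\<in>form_domain m D A. \<forall>\<phi> \<psi>.
           form_converges m D A \<phi> f \<longrightarrow> form_converges m D A \<psi> h \<longrightarrow>
           (\<lambda>n. l2_inner m (A (\<phi> n)) (\<psi> n)) \<longlonglongrightarrow> l2_inner m g h)}"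

definition graph_operator ::
    "('a::countable \<Rightarrow> 'a \<Rightarrow> real) \<Rightarrow> ('a \<Rightarrow> real) \<Rightarrow> (('a \<Rightarrow> real) \<times> ('a \<Rightarrow> real)) set" where
  "graph_operator b m = friedrichs_extension m Cc (\<lambda>f x. - laplacian b m f x)"


section \<open>The heat semigroup\<close>

definition l2_C0_semigroup ::
    "('a::countable \<Rightarrow> real) \<Rightarrow> (real \<Rightarrow> ('a \<Rightarrow> real) \<Rightarrow> 'a \<Rightarrow> real) \<Rightarrow> bool" where
  "l2_C0_semigroup m T \<longleftrightarrow>
     (\<forall>t\<ge>0. \<forall>f\<in>l2 m. T t f \<in> l2 m) \<and>
     (\<forall>t\<ge>0. \<forall>f\<in>l2 m. \<forall>g\<in>l2 m. \<forall>\<alpha> \<beta>.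
        T t (\<lambda>x. \<alpha> * f x + \<beta> * g x) = (\<lambda>x. \<alpha> * T t f x + \<beta> * T t g x)) \<and>
     (\<forall>t\<ge>0. \<exists>M. \<forall>f\<in>l2 m. l2_norm m (T t f) \<le> M * l2_norm m f) \<and>
     (\<forall>f\<in>l2 m. T 0 f = f) \<and>
     (\<forall>s\<ge>0. \<forall>t\<ge>0. \<forall>f\<in>l2 m. T (s + t) f = T s (T t f)) \<and>
     (\<forall>f\<in>l2 m. ((\<lambda>t. l2_norm m (\<lambda>x. T t f x - f x)) \<longlongrightarrow> 0) (at_right 0))"

definition l2_generator ::
    "('a::countable \<Rightarrow> real) \<Rightarrow> (real \<Rightarrow> ('a \<Rightarrow> real) \<Rightarrow> 'a \<Rightarrow> real) \<Rightarrow>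
     (('a \<Rightarrow> real) \<times> ('a \<Rightarrow> real)) set" where
  "l2_generator m T =
     {(f, g). f \<in> l2 m \<and> g \<in> l2 m \<and>
        ((\<lambda>t. l2_norm m (\<lambda>x. (T t f x - f x) / t - g x)) \<longlongrightarrow> 0) (at_right 0)}"

text \<open>\<open>P\<^sub>t = exp(-tL)\<close> on \<open>l2 m\<close>, \<open>L\<close> the Friedrichs extension: the strongly continuous semigroup
  with generator \<open>-L\<close>. It exists since \<open>L\<close> is self-adjoint and positive, and the generator
  determines \<open>P t f\<close> for \<open>t \<ge> 0\<close> and \<open>f \<in> l2 m\<close>; other values of \<open>P\<close> are irrelevant.\<close>

definition heat_semigroup ::
    "('a::countable \<Rightarrow> 'a \<Rightarrow> real) \<Rightarrow> ('a \<Rightarrow> real) \<Rightarrow> (real \<Rightarrow> ('a \<Rightarrow> real) \<Rightarrow> 'a \<Rightarrow> real) \<Rightarrow> bool" where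
  "heat_semigroup b m P \<longleftrightarrow>
     l2_C0_semigroup m P \<and>
     l2_generator m P = {(f, \<lambda>x. - g x) | f g. (f, g) \<in> graph_operator b m}"

definition heat_kernel ::
    "('a::countable \<Rightarrow> real) \<Rightarrow> (real \<Rightarrow> ('a \<Rightarrow> real) \<Rightarrow> 'a \<Rightarrow> real) \<Rightarrow> real \<Rightarrow> 'a \<Rightarrow> 'a \<Rightarrow> real" where
  "heat_kernel m P t x y = P t (indicator {y}) x / m y"

text \<open>The extension of the heat semigroup from \<open>l2 m\<close> to all spaces \<open>\<ell>\<^sup>p\<close>, in particular to the
  bounded functions.\<close>

definition heat_extension ::
    "('a::countable \<Rightarrow> real) \<Rightarrow> (real \<Rightarrow> ('a \<Rightarrow> real) \<Rightarrow> 'a \<Rightarrow> real) \<Rightarrow>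
     real \<Rightarrow> ('a \<Rightarrow> real) \<Rightarrow> 'a \<Rightarrow> real" where
  "heat_extension m P t f x = (\<Sum>\<^sub>\<infinity>y. heat_kernel m P t x y * f y * m y)"

definition feller ::
    "('a::countable \<Rightarrow> real) \<Rightarrow> (real \<Rightarrow> ('a \<Rightarrow> real) \<Rightarrow> 'a \<Rightarrow> real) \<Rightarrow> bool" where
  "feller m P \<longleftrightarrow> (\<forall>t\<ge>0. heat_extension m P t ` C0 \<subseteq> C0)"

definition stochastically_complete ::
    "('a::countable \<Rightarrow> real) \<Rightarrow> (real \<Rightarrow> ('a \<Rightarrow> real) \<Rightarrow> 'a \<Rightarrow> real) \<Rightarrow> bool" where
  "stochastically_complete m P \<longleftrightarrow> (\<forall>t\<ge>0. heat_extension m P t (\<lambda>_. 1) = (\<lambda>_. 1))"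

end

theory Submission
  imports Defs
begin

text \<open>For \<open>f\<close> in \<open>C\<^sub>c\<close> and \<open>u = P\<^sub>t f\<close>, the condition \<open>CD(0,\<infinity>)\<close> makes
  \<open>2 t \<Gamma>(u) + u\<^sup>2\<close> a subsolution of the heat equation. Ellipticity gives
  \<open>\<Gamma>(u) \<le> C/2 \<Sum> u\<^sup>2 m + \<bar>u \<Delta>u\<bar>\<close>, the sum ranging over the neighbours of a vertex; here
  \<open>\<Delta>u = P\<^sub>t \<Delta>f\<close> is bounded, \<open>u\<close> is square summable and, by the Feller property, in \<open>C\<^sub>0\<close>.
  Hence the subsolution vanishes at infinity and the elementary maximum principle yields
  \<open>2 t \<Gamma>(P\<^sub>t f) \<le> \<parallel>f\<parallel>\<^sub>\<infinity>\<^sup>2\<close>. Stochastic completeness makes \<open>P\<^sub>t 1\<^sub>F\<close> close to \<open>1\<close> on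
  any prescribed finite set once the finite set \<open>F\<close> is large; truncating \<open>P\<^sub>t 1\<^sub>F\<close> for large \<open>t\<close>
  produces the cutoff functions.\<close>

text \<open>Two obstacles shape the proof. First, \<open>P\<close> is known only as the strongly
  continuous semigroup with generator -L: local bounds and differentiability of orbits, the action
  of L as -\<Delta>, the identity \<Delta> P_t f = P_t \<Delta>f and the contraction in the supremum
  norm all have to be extracted from the form. Second, the maximum principle needs smallness outside
  one finite set for all times in [0,T] at once, whereas the Feller property concerns single times.
  For u a finite net of times and a Lipschitz bound in time close the gap, for its squares the
  compactness of the orbit in l2. The weight 2 t is forced: its derivative produces 2 \<Gamma>(u),
  exactly the \<Gamma> term of \<Delta>(u^2). After the terms 2 u \<Delta>u cancel as well, \<Delta>
  of the subsolution minus its time derivative is 4 t \<Gamma>_2(u) \<ge> 0.\<close>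

section \<open>The Hilbert space of square summable functions\<close>

text \<open>A type rather than a set of functions, so that general facts on derivatives, compactness
  and Baire category apply. It is unweighted; the measure enters through \<open>to_ell2\<close> and
  \<open>of_ell2\<close>.\<close>

typedef 'a ell2 = "{f :: 'a \<Rightarrow> real. (\<lambda>x. (f x)\<^sup>2) summable_on UNIV}"
  morphisms coord Abs_ell2
  by (rule exI[of _ "\<lambda>_. 0"]) simp

setup_lifting type_definition_ell2

lemma coord_square_summable: "(\<lambda>x. (coord h x)\<^sup>2) summable_on UNIV"
  using coord by auto

lemma ell2_eqI: "(\<And>x. coord g x = coord h x) \<Longrightarrow> g = h"
  by (metis coord_inject ext)

lemma square_summable_product:
  fixes f g :: "'a \<Rightarrow> real"
  assumes "(\<lambda>x. (f x)\<^sup>2) summable_on UNIV" "(\<lambda>x. (g x)\<^sup>2) summable_on UNIV"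
  shows "(\<lambda>x. f x * g x) summable_on UNIV"
proof -
  have "(\<lambda>x. norm (f x * g x)) summable_on UNIV"
    by (rule abs_summable_product) (use assms in \<open>simp_all add: power2_eq_square\<close>)
  then show ?thesis
    using summable_on_iff_abs_summable_on_real by blast
qed

lemma square_summable_add:
  fixes f g :: "'a \<Rightarrow> real"
  assumes "(\<lambda>x. (f x)\<^sup>2) summable_on UNIV" "(\<lambda>x. (g x)\<^sup>2) summable_on UNIV"
  shows "(\<lambda>x. (f x + g x)\<^sup>2) summable_on UNIV"
  using summable_on_add[OF summable_on_add[OF assms]
      summable_on_cmult_right[OF square_summable_product[OF assms], of 2]]
  by (simp add: power2_sum mult.assoc)

lemma square_summable_scale:
  fixes f :: "'a \<Rightarrow> real"
  assumes "(\<lambda>x. (f x)\<^sup>2) summable_on UNIV"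
  shows "(\<lambda>x. (c * f x)\<^sup>2) summable_on UNIV"
  using summable_on_cmult_right[OF assms, of "c\<^sup>2"] by (simp add: power_mult_distrib)

instantiation ell2 :: (type) real_vector
begin

lift_definition zero_ell2 :: "'a ell2" is "\<lambda>_. 0" by simp

lift_definition plus_ell2 :: "'a ell2 \<Rightarrow> 'a ell2 \<Rightarrow> 'a ell2" is "\<lambda>f g x. f x + g x"
  by (rule square_summable_add)

lift_definition scaleR_ell2 :: "real \<Rightarrow> 'a ell2 \<Rightarrow> 'a ell2" is "\<lambda>c f x. c * f x"
  by (rule square_summable_scale)

lift_definition uminus_ell2 :: "'a ell2 \<Rightarrow> 'a ell2" is "\<lambda>f x. - f x"
  by simp

definition minus_ell2 :: "'a ell2 \<Rightarrow> 'a ell2 \<Rightarrow> 'a ell2" where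
  "minus_ell2 f g = f + (- g)"

instance
proof
  fix f g h :: "'a ell2" and r s :: real
  show "f + g + h = f + (g + h)" by transfer (simp add: add.assoc)
  show "f + g = g + f" by transfer (simp add: add.commute)
  show "0 + f = f" by transfer simp
  show "- f + f = 0" by transfer simp
  show "f - g = f + - g" by (rule minus_ell2_def)
  show "r *\<^sub>R (f + g) = r *\<^sub>R f + r *\<^sub>R g" by transfer (simp add: distrib_left)
  show "(r + s) *\<^sub>R f = r *\<^sub>R f + s *\<^sub>R f" by transfer (simp add: distrib_right)
  show "r *\<^sub>R s *\<^sub>R f = (r * s) *\<^sub>R f" by transfer (simp add: mult.assoc)
  show "1 *\<^sub>R f = f" by transfer simp
qed

end

lemma coord_zero [simp]: "coord 0 x = 0"
  by transfer simp

lemma coord_add [simp]: "coord (g + h) x = coord g x + coord h x"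
  by transfer simp

lemma coord_scaleR [simp]: "coord (c *\<^sub>R h) x = c * coord h x"
  by transfer simp

lemma coord_uminus [simp]: "coord (- h) x = - coord h x"
  by transfer simp

lemma coord_diff [simp]: "coord (g - h) x = coord g x - coord h x"
  unfolding minus_ell2_def coord_add coord_uminus by simp

lemma coord_mult_summable: "(\<lambda>x. coord g x * coord h x) summable_on UNIV"
  by (intro square_summable_product coord_square_summable)

instantiation ell2 :: (type) real_inner
begin

definition inner_ell2 :: "'a ell2 \<Rightarrow> 'a ell2 \<Rightarrow> real" where
  "inner_ell2 g h = (\<Sum>\<^sub>\<infinity>x. coord g x * coord h x)"

definition norm_ell2 :: "'a ell2 \<Rightarrow> real" where
  "norm_ell2 h = sqrt (inner h h)"

definition dist_ell2 :: "'a ell2 \<Rightarrow> 'a ell2 \<Rightarrow> real" where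
  "dist_ell2 g h = norm (g - h)"

definition sgn_ell2 :: "'a ell2 \<Rightarrow> 'a ell2" where
  "sgn_ell2 h = h /\<^sub>R norm h"

definition uniformity_ell2 :: "('a ell2 \<times> 'a ell2) filter" where
  "uniformity_ell2 = (INF e\<in>{0 <..}. principal {(x, y). dist x y < e})"

definition open_ell2 :: "'a ell2 set \<Rightarrow> bool" where
  "open_ell2 U = (\<forall>x\<in>U. \<forall>\<^sub>F (x', y) in uniformity. x' = x \<longrightarrow> y \<in> U)"

instance
proof
  fix x y z :: "'a ell2" and r :: real
  show "inner x y = inner y x"
    by (simp add: inner_ell2_def mult.commute)
  show "inner (x + y) z = inner x z + inner y z"
    unfolding inner_ell2_def
    by (subst infsum_add[symmetric])
      (auto intro!: coord_mult_summable simp: distrib_right)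
  show "inner (r *\<^sub>R x) y = r * inner x y"
    unfolding inner_ell2_def by (simp add: infsum_cmult_right' mult.assoc)
  show "0 \<le> inner x x"
    by (simp add: inner_ell2_def infsum_nonneg)
  show "inner x x = 0 \<longleftrightarrow> x = 0"
  proof
    assume "inner x x = 0"
    then have "coord x a * coord x a = 0" for a
      by (intro nonneg_infsum_le_0D[where A=UNIV and f="\<lambda>a. coord x a * coord x a"])
        (auto simp: inner_ell2_def coord_mult_summable)
    then show "x = 0"
      by (intro ell2_eqI) simp
  qed (simp add: inner_ell2_def)
qed (simp_all add: norm_ell2_def dist_ell2_def sgn_ell2_def uniformity_ell2_def open_ell2_def)

end

lemma norm_ell2_square: "(norm h)\<^sup>2 = (\<Sum>\<^sub>\<infinity>x. (coord h x)\<^sup>2)"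
  unfolding power2_norm_eq_inner inner_ell2_def by (simp add: power2_eq_square)

lemma sum_coord_square_le: "finite A \<Longrightarrow> (\<Sum>x\<in>A. (coord h x)\<^sup>2) \<le> (norm h)\<^sup>2"
  unfolding norm_ell2_square
  by (intro finite_sum_le_infsum coord_square_summable) auto

lemma abs_coord_le: "\<bar>coord h x\<bar> \<le> norm h"
  using sum_coord_square_le[of "{x}" h] by (simp add: abs_le_square_iff[symmetric])

lemma bounded_linear_coord: "bounded_linear (\<lambda>h. coord h x)"
  by (rule bounded_linear_intro[where K=1]) (auto simp: abs_coord_le)

lemma ell2_boundedI:
  assumes "\<And>A. finite A \<Longrightarrow> (\<Sum>x\<in>A. (f x)\<^sup>2) \<le> c\<^sup>2" and "0 \<le> c"
  obtains h where "\<And>x. coord h x = f x" and "norm h \<le> c"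
proof -
  have s: "(\<lambda>x. (f x)\<^sup>2) summable_on UNIV"
    by (rule nonneg_bdd_above_summable_on) (auto intro!: bdd_aboveI2 assms)
  define h where "h = Abs_ell2 f"
  have h: "coord h x = f x" for x
    using s by (simp add: h_def Abs_ell2_inverse)
  have "(norm h)\<^sup>2 \<le> c\<^sup>2"
    unfolding norm_ell2_square by (auto simp: h intro!: infsum_le_finite_sums s assms)
  then show ?thesis
    using that h assms(2) by (meson power2_le_imp_le)
qed

instance ell2 :: (type) complete_space
proof
  fix X :: "nat \<Rightarrow> 'a ell2"
  assume X: "Cauchy X"
  have "convergent (\<lambda>n. coord (X n) x)" for x
    by (rule Cauchy_convergent, rule bounded_linear.Cauchy[OF bounded_linear_coord X])
  then have "\<exists>l. \<forall>x. (\<lambda>n. coord (X n) x) \<longlonglongrightarrow> l x"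
    by (intro choice) (auto simp: convergent_def)
  then obtain l where l: "\<And>x. (\<lambda>n. coord (X n) x) \<longlonglongrightarrow> l x"
    by blast
  \<comment> \<open>Finite partial sums pass to the limit in \<open>k\<close>, so the coordinatewise
    limit \<open>l\<close> differs from \<open>X n\<close> by a square summable function of norm at
    most \<open>e\<close>.\<close>
  have tail: "\<exists>h. (\<forall>x. coord h x = l x - coord (X n) x) \<and> norm h \<le> e"
    if e: "0 < e" and n: "\<And>k. k \<ge> n \<Longrightarrow> norm (X k - X n) \<le> e" for e n
  proof -
    have "(\<Sum>x\<in>A. (l x - coord (X n) x)\<^sup>2) \<le> e\<^sup>2" if "finite A" for A
    proof (rule LIMSEQ_le_const2)
      show "(\<lambda>k. \<Sum>x\<in>A. (coord (X k) x - coord (X n) x)\<^sup>2) \<longlonglongrightarrow> (\<Sum>x\<in>A. (l x - coord (X n) x)\<^sup>2)"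
        by (intro tendsto_intros l)
      have "(\<Sum>x\<in>A. (coord (X k) x - coord (X n) x)\<^sup>2) \<le> e\<^sup>2" if "k \<ge> n" for k
        using sum_coord_square_le[OF \<open>finite A\<close>, of "X k - X n"] power_mono[OF n[OF that], of 2]
        by auto
      then show "\<exists>N. \<forall>k\<ge>N. (\<Sum>x\<in>A. (coord (X k) x - coord (X n) x)\<^sup>2) \<le> e\<^sup>2"
        by blast
    qed
    then show ?thesis
      using e by (elim ell2_boundedI) auto
  qed
  have ev: "\<exists>N. \<forall>n\<ge>N. \<forall>k\<ge>n. norm (X k - X n) \<le> e" if "0 < e" for e
    using CauchyD[OF X that] by (meson less_imp_le order_trans)
  obtain N where "\<forall>k\<ge>N. norm (X k - X N) \<le> 1"
    using ev[of 1] by auto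
  then obtain h where h: "\<forall>x. coord h x = l x - coord (X N) x"
    using tail[of 1 N] by auto
  have "X \<longlonglongrightarrow> X N + h"
  proof (rule LIMSEQ_I)
    fix r :: real assume r: "0 < r"
    then obtain M where M: "\<forall>n\<ge>M. \<forall>k\<ge>n. norm (X k - X n) \<le> r / 2"
      using ev[of "r / 2"] by auto
    have "norm (X n - (X N + h)) < r" if "n \<ge> M" for n
    proof -
      have "\<exists>g. (\<forall>x. coord g x = l x - coord (X n) x) \<and> norm g \<le> r / 2"
        by (rule tail) (use M that r in auto)
      then obtain g where g: "\<forall>x. coord g x = l x - coord (X n) x" "norm g \<le> r / 2"
        by blast
      have "X n - (X N + h) = - g"
        by (rule ell2_eqI) (simp add: g h)
      then show ?thesis
        using g r by simp
    qed
    then show "\<exists>M. \<forall>n\<ge>M. norm (X n - (X N + h)) < r"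
      by blast
  qed
  then show "convergent X"
    by (auto simp: convergent_def)
qed

lemma ell2_tail:
  assumes "0 < e"
  obtains A where "finite A" "\<And>B. finite B \<Longrightarrow> B \<inter> A = {} \<Longrightarrow> (\<Sum>x\<in>B. (coord h x)\<^sup>2) \<le> e"
proof -
  have "((\<lambda>A. \<Sum>x\<in>A. (coord h x)\<^sup>2) \<longlongrightarrow> (norm h)\<^sup>2) (finite_subsets_at_top UNIV)"
    unfolding norm_ell2_square by (intro infsum_tendsto coord_square_summable)
  then have "\<forall>\<^sub>F A in finite_subsets_at_top UNIV. (norm h)\<^sup>2 - e < (\<Sum>x\<in>A. (coord h x)\<^sup>2)"
    by (rule order_tendstoD) (use assms in simp)
  then obtain A where A: "finite A" "(norm h)\<^sup>2 - e < (\<Sum>x\<in>A. (coord h x)\<^sup>2)"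
    by (auto simp: eventually_finite_subsets_at_top)
  show ?thesis
  proof
    fix B assume B: "finite B" "B \<inter> A = {}"
    have "(\<Sum>x\<in>B. (coord h x)\<^sup>2) + (\<Sum>x\<in>A. (coord h x)\<^sup>2) \<le> (norm h)\<^sup>2"
      using sum_coord_square_le[of "B \<union> A" h] A B by (simp add: sum.union_disjoint)
    then show "(\<Sum>x\<in>B. (coord h x)\<^sup>2) \<le> e"
      using A by simp
  qed (rule A)
qed


section \<open>Strongly continuous semigroups\<close>

locale C0_semigroup =
  fixes S :: "real \<Rightarrow> 'h::{real_normed_vector, complete_space} \<Rightarrow> 'h"
  assumes bounded_linear: "0 \<le> t \<Longrightarrow> bounded_linear (S t)"
    and zero: "S 0 h = h"
    and add: "0 \<le> s \<Longrightarrow> 0 \<le> t \<Longrightarrow> S (s + t) h = S s (S t h)"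
    and right_continuous: "((\<lambda>t. S t h) \<longlongrightarrow> h) (at_right 0)"
begin

definition has_generator :: "'h \<Rightarrow> 'h \<Rightarrow> bool" where
  "has_generator h g \<longleftrightarrow> ((\<lambda>t. (S t h - h) /\<^sub>R t) \<longlongrightarrow> g) (at_right 0)"

text \<open>Strong continuity at 0 bounds each orbit separately, and each operator is bounded
  separately; Baire's theorem makes the bounds uniform.\<close>

lemma bounded_near_zero:
  obtains \<delta> M where "0 < \<delta>" "1 \<le> M" "\<And>t h. 0 \<le> t \<Longrightarrow> t \<le> \<delta> \<Longrightarrow> norm (S t h) \<le> M * norm h"
proof -
  \<comment> \<open>One index governs both the bound and the time interval: a larger
    \<open>n\<close> weakens the former and shortens the latter, so every \<open>h\<close> lies in
    some \<open>A n\<close>.\<close>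
  define A where "A n = (\<Inter>t\<in>{0..1 / real (Suc n)}. {h. norm (S t h) \<le> real (Suc n)})" for n
  have clA: "closed (A n)" for n
    unfolding A_def
    by (intro closed_INT ballI closed_Collect_le continuous_intros
        linear_continuous_on bounded_linear) auto
  have "\<exists>n. h \<in> A n" for h
  proof -
    have "\<forall>\<^sub>F t in at_right 0. norm (S t h) < norm h + 1"
      by (rule order_tendstoD[OF tendsto_norm[OF right_continuous]]) simp
    then obtain d where d: "0 < d" "\<And>t. 0 < t \<Longrightarrow> t < d \<Longrightarrow> norm (S t h) < norm h + 1"
      by (auto simp: eventually_at_right_field)
    obtain n1 where n1: "norm h + 1 < real n1"
      using reals_Archimedean2 by blast
    obtain n2 where n2: "1 / d < real n2"
      using reals_Archimedean2 by blast
    define n where "n = max n1 n2"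
    have "1 / d < real (Suc n)" "norm h + 1 < real (Suc n)"
      using n1 n2 by (auto simp: n_def)
    then have n: "1 / real (Suc n) < d" "norm h + 1 < real (Suc n)"
      using d(1) by (auto simp: field_simps)
    have "norm (S t h) \<le> real (Suc n)" if "t \<in> {0..1 / real (Suc n)}" for t
    proof (cases "t = 0")
      case True
      then show ?thesis
        using n zero by simp
    next
      case False
      then have "norm (S t h) < norm h + 1"
        using n that by (intro d(2)) auto
      then show ?thesis
        using n by simp
    qed
    then show ?thesis
      unfolding A_def by blast
  qed
  then have cover: "\<Union>(range A) = UNIV"
    by blast
  have "\<exists>n. interior (A n) \<noteq> {}"
  proof (rule ccontr)
    assume "\<nexists>n. interior (A n) \<noteq> {}"
    then have "Met_TC.mtopology interior_of \<Union>(range A) = {}"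
      by (intro Met_TC.metric_Baire_category_alt)
        (auto simp: clA complete_UNIV)
    then show False
      by (simp add: cover)
  qed
  then obtain n x where "x \<in> interior (A n)"
    by blast
  then obtain r where r: "0 < r" "cball x r \<subseteq> A n"
    by (meson interior_subset mem_interior_cball)
  have est: "norm (S t h) \<le> max 1 (2 * real (Suc n) / r) * norm h"
    if t: "0 \<le> t" "t \<le> 1 / real (Suc n)" for t h
  proof (cases "h = 0")
    case True
    then show ?thesis
      using linear_0[OF bounded_linear.linear[OF bounded_linear[OF t(1)]]] by simp
  next
    case False
    interpret St: bounded_linear "S t"
      by (rule bounded_linear[OF t(1)])
    \<comment> \<open>Scaling \<open>h\<close> to norm \<open>r\<close> puts both \<open>x\<close>
      and \<open>x + c *\<^sub>R h\<close> into the ball inside \<open>A n\<close>; taking their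
      difference costs the factor 2.\<close>
    define c where "c = r / norm h"
    have c: "c > 0" "norm (c *\<^sub>R h) = r"
      using False r by (auto simp: c_def)
    have "x \<in> cball x r" "x + c *\<^sub>R h \<in> cball x r"
      using c(2) r(1) by (auto simp: dist_norm simp del: norm_scaleR)
    moreover have "norm (S t y) \<le> real (Suc n)" if "y \<in> cball x r" for y
    proof -
      have "y \<in> A n"
        using r(2) that by blast
      then have "y \<in> {h. norm (S t h) \<le> real (Suc n)}"
        unfolding A_def using t by (elim INT_D) simp
      then show ?thesis
        by blast
    qed
    ultimately have "norm (S t x) \<le> real (Suc n)" "norm (S t (x + c *\<^sub>R h)) \<le> real (Suc n)"
      by blast+
    moreover have "c *\<^sub>R S t h = S t (x + c *\<^sub>R h) - S t x"
      by (simp add: St.add St.scaleR)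
    ultimately have "norm (c *\<^sub>R S t h) \<le> 2 * real (Suc n)"
      using norm_triangle_ineq4[of "S t (x + c *\<^sub>R h)" "S t x"] by simp
    then have "norm (S t h) \<le> (2 * real (Suc n) / r) * norm h"
      using c(1) False r(1) by (simp add: c_def field_simps)
    also have "\<dots> \<le> max 1 (2 * real (Suc n) / r) * norm h"
      by (intro mult_right_mono) auto
    finally show ?thesis .
  qed
  show ?thesis
    by (rule that[of "1 / real (Suc n)" "max 1 (2 * real (Suc n) / r)"]) (use est in auto)
qed

text \<open>Each further step of length \<open>\<delta>\<close> multiplies the bound by
  \<open>M\<close>; \<open>1 \<le> M\<close> covers the shorter times.\<close>

lemma locally_bounded:
  obtains M where "1 \<le> M" "\<And>t h. 0 \<le> t \<Longrightarrow> t \<le> T \<Longrightarrow> norm (S t h) \<le> M * norm h"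
proof -
  obtain \<delta> M where M: "0 < \<delta>" "1 \<le> M" "\<And>t h. 0 \<le> t \<Longrightarrow> t \<le> \<delta> \<Longrightarrow> norm (S t h) \<le> M * norm h"
    using bounded_near_zero by blast
  have step: "norm (S t h) \<le> M ^ Suc k * norm h" if "0 \<le> t" "t \<le> real (Suc k) * \<delta>" for t k h
    using that
  proof (induction k arbitrary: t h)
    case 0
    then show ?case using M by simp
  next
    case (Suc k)
    show ?case
    proof (cases "t \<le> \<delta>")
      case True
      have "M * norm h \<le> M ^ Suc (Suc k) * norm h"
        using power_increasing[of 1 "Suc (Suc k)" M] M(2) by (intro mult_right_mono) auto
      then show ?thesis
        using M(3)[OF Suc.prems(1) True, of h] by linarith
    next
      case False
      have "S t h = S (t - \<delta>) (S \<delta> h)"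
        using add[of "t - \<delta>" \<delta> h] False M(1) by simp
      also have "norm \<dots> \<le> M ^ Suc k * norm (S \<delta> h)"
        using False Suc.prems by (intro Suc.IH) (auto simp: algebra_simps)
      also have "\<dots> \<le> M ^ Suc k * (M * norm h)"
        using M by (intro mult_left_mono) auto
      finally show ?thesis
        by (simp add: mult_ac)
    qed
  qed
  obtain k where "T / \<delta> < real k"
    using reals_Archimedean2 by blast
  then have "T \<le> real (Suc k) * \<delta>"
    using M(1) by (simp add: field_simps)
  then have "\<And>t h. 0 \<le> t \<Longrightarrow> t \<le> T \<Longrightarrow> norm (S t h) \<le> M ^ Suc k * norm h"
    using order_trans[of _ T "real (Suc k) * \<delta>"] step[of _ k] by blast
  then show ?thesis
    using M(2) by (intro that[of "M ^ Suc k"] one_le_power)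
qed

text \<open>For \<open>v < u\<close>, \<open>S u h - S v h\<close> is \<open>S v\<close> applied to
  \<open>S (u - v) h - h\<close>. The local bound on \<open>S v\<close> thus turns right continuity
  at 0 into continuity from both sides.\<close>

lemma continuous_on_orbit: "continuous_on {0..} (\<lambda>t. S t h)"
proof -
  have "\<exists>d>0. \<forall>t\<ge>0. dist t s < d \<longrightarrow> dist (S t h) (S s h) < e" if s: "0 \<le> s" and e: "0 < e" for s e
  proof -
    obtain M where M: "1 \<le> M" "\<And>t h. 0 \<le> t \<Longrightarrow> t \<le> s + 1 \<Longrightarrow> norm (S t h) \<le> M * norm h"
      using locally_bounded by blast
    have "\<forall>\<^sub>F t in at_right 0. dist (S t h) h < e / M"
      using right_continuous e M(1) by (intro tendstoD) auto
    then obtain d where d: "0 < d" "\<And>t. 0 < t \<Longrightarrow> t < d \<Longrightarrow> dist (S t h) h < e / M"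
      by (auto simp: eventually_at_right_field)
    have *: "norm (S u h - S v h) < e" if "0 \<le> v" "v < u" "u \<le> s + 1" "u - v < d" for u v
    proof -
      interpret Sv: bounded_linear "S v"
        by (rule bounded_linear[OF that(1)])
      have "S u h - S v h = S v (S (u - v) h - h)"
        using add[of v "u - v" h] that by (simp add: Sv.diff)
      also have "norm \<dots> \<le> M * norm (S (u - v) h - h)"
        using that by (intro M) auto
      also have "\<dots> < M * (e / M)"
        using d(2)[of "u - v"] that M(1) by (intro mult_strict_left_mono) (auto simp: dist_norm)
      finally show ?thesis
        using M(1) by simp
    qed
    have "dist (S t h) (S s h) < e" if "0 \<le> t" "dist t s < min d 1" for t
      using *[of s t] *[of t s] that s e
      by (cases s t rule: linorder_cases) (auto simp: dist_norm norm_minus_commute)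
    then show ?thesis
      using d(1) by (intro exI[of _ "min d 1"]) auto
  qed
  then show ?thesis
    unfolding continuous_on_iff by (metis atLeast_iff)
qed

lemma has_generator_orbit:
  assumes "has_generator h g" "0 \<le> t"
  shows "has_generator (S t h) (S t g)"
proof -
  interpret St: bounded_linear "S t"
    by (rule bounded_linear[OF assms(2)])
  have "((\<lambda>s. S t ((S s h - h) /\<^sub>R s)) \<longlongrightarrow> S t g) (at_right 0)"
    using assms(1) unfolding has_generator_def by (rule St.tendsto)
  moreover have "\<forall>\<^sub>F s in at_right 0. S t ((S s h - h) /\<^sub>R s) = (S s (S t h) - S t h) /\<^sub>R s"
    using eventually_at_right_less[of 0]
  proof eventually_elim
    case (elim s)
    then show ?case
      using add[of s t h] add[of t s h] assms(2) by (simp add: St.scaleR St.diff add.commute)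
  qed
  ultimately show ?thesis
    unfolding has_generator_def by (simp add: filterlim_cong)
qed

text \<open>The generator is only a right derivative at 0. For \<open>s < t\<close> the quotient is
  referred to the earlier time \<open>s\<close> and approximates \<open>S s g\<close>, which
  continuity of the orbit of \<open>g\<close> replaces by \<open>S t g\<close>.\<close>

lemma has_vector_derivative_orbit:
  assumes g: "has_generator h g" and t: "0 \<le> t"
  shows "((\<lambda>s. S s h) has_vector_derivative S t g) (at t within {0..})"
proof -
  obtain M where M: "1 \<le> M" "\<And>s h. 0 \<le> s \<Longrightarrow> s \<le> t + 1 \<Longrightarrow> norm (S s h) \<le> M * norm h"
    using locally_bounded by blast
  have "\<exists>d>0. \<forall>s\<in>{0..}. 0 < \<bar>s - t\<bar> \<and> \<bar>s - t\<bar> < d \<longrightarrow>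
      norm ((S s h - S t h) /\<^sub>R (s - t) - S t g) < e" if e: "0 < e" for e
  proof -
    have "\<forall>\<^sub>F s in at_right 0. dist ((S s h - h) /\<^sub>R s) g < e / (2 * M)"
      using g e M(1) unfolding has_generator_def by (intro tendstoD) auto
    then obtain d1 where d1: "0 < d1"
      "\<And>s. 0 < s \<Longrightarrow> s < d1 \<Longrightarrow> norm ((S s h - h) /\<^sub>R s - g) < e / (2 * M)"
      by (auto simp: eventually_at_right_field dist_norm)
    obtain d2 where d2: "0 < d2" "\<And>s. 0 \<le> s \<Longrightarrow> dist s t < d2 \<Longrightarrow> norm (S s g - S t g) < e / 2"
      using continuous_on_orbit[of g] t e unfolding continuous_on_iff dist_norm
      by (metis atLeast_iff half_gt_zero)
    have *: "norm ((S u h - S v h) /\<^sub>R (u - v) - S v g) < e / 2"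
      if "0 \<le> v" "v < u" "u \<le> t + 1" "u - v < d1" for u v
    proof -
      interpret Sv: bounded_linear "S v"
        by (rule bounded_linear[OF that(1)])
      have "(S u h - S v h) /\<^sub>R (u - v) - S v g = S v ((S (u - v) h - h) /\<^sub>R (u - v) - g)"
        using add[of v "u - v" h] that by (simp add: Sv.diff Sv.scaleR)
      also have "norm \<dots> \<le> M * norm ((S (u - v) h - h) /\<^sub>R (u - v) - g)"
        using that by (intro M) auto
      also have "\<dots> < M * (e / (2 * M))"
        using d1(2)[of "u - v"] that M(1) by (intro mult_strict_left_mono) auto
      finally show ?thesis
        using M(1) by simp
    qed
    have "norm ((S s h - S t h) /\<^sub>R (s - t) - S t g) < e"
      if s: "0 \<le> s" "0 < \<bar>s - t\<bar>" "\<bar>s - t\<bar> < min 1 (min d1 d2)" for s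
    proof (cases "t < s")
      case True
      then show ?thesis
        using *[of t s] s t e by auto
    next
      case False
      have "(S s h - S t h) /\<^sub>R (s - t) = (S t h - S s h) /\<^sub>R (t - s)"
        by (metis minus_diff_eq inverse_minus_eq scaleR_minus_left scaleR_minus_right minus_minus)
      then have "(S s h - S t h) /\<^sub>R (s - t) - S t g =
          ((S t h - S s h) /\<^sub>R (t - s) - S s g) + (S s g - S t g)"
        by simp
      also have "norm \<dots> < e / 2 + e / 2"
        using *[of s t] d2(2)[of s] s False
        by (intro norm_add_less) (auto simp: dist_norm)
      finally show ?thesis by simp
    qed
    then show ?thesis
      using d1(1) d2(1) by (intro exI[of _ "min 1 (min d1 d2)"]) auto
  qed
  then have "((\<lambda>s. norm ((S s h - S t h) /\<^sub>R (s - t) - S t g)) \<longlongrightarrow> 0) (at t within {0..})"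
    unfolding Lim_within dist_norm by auto
  moreover have "\<forall>\<^sub>F s in at t within {0..}. norm ((S s h - S t h) /\<^sub>R (s - t) - S t g) =
      norm (S s h - S t h - (s - t) *\<^sub>R S t g) / norm (s - t)"
    unfolding eventually_at_filter
  proof (intro always_eventually allI impI)
    fix s assume "s \<noteq> t"
    then have "(S s h - S t h) /\<^sub>R (s - t) - S t g =
        (S s h - S t h - (s - t) *\<^sub>R S t g) /\<^sub>R (s - t)"
      by (simp add: scaleR_diff_right)
    then show "norm ((S s h - S t h) /\<^sub>R (s - t) - S t g) =
      norm (S s h - S t h - (s - t) *\<^sub>R S t g) / norm (s - t)"
      by (simp add: divide_inverse_commute)
  qed
  ultimately have "((\<lambda>s. norm (S s h - S t h - (s - t) *\<^sub>R S t g) / norm (s - t)) \<longlongrightarrow> 0)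
      (at t within {0..})"
    by (simp only: filterlim_cong)
  then show ?thesis
    unfolding has_vector_derivative_def has_derivative_iff_norm
    by (simp add: bounded_linear_scaleR_left)
qed

end


section \<open>Weighted square summable functions\<close>

text \<open>Multiplication by the square root of \<open>m\<close> is an isometry of the weighted
  onto the unweighted space. Outside \<open>l2 m\<close> the value of \<open>Abs_ell2\<close> is
  unspecified, hence the membership hypotheses below.\<close>

definition to_ell2 :: "('a::countable \<Rightarrow> real) \<Rightarrow> ('a \<Rightarrow> real) \<Rightarrow> 'a ell2" where
  "to_ell2 m f = Abs_ell2 (\<lambda>x. f x * sqrt (m x))"

definition of_ell2 :: "('a::countable \<Rightarrow> real) \<Rightarrow> 'a ell2 \<Rightarrow> 'a \<Rightarrow> real" where
  "of_ell2 m h x = coord h x / sqrt (m x)"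

locale discrete_measure_space =
  fixes m :: "'a::countable \<Rightarrow> real"
  assumes measure: "discrete_measure m"
begin

lemma m_pos [simp]: "0 < m x"
  using measure by (auto simp: discrete_measure_def)

lemma m_nonneg [simp]: "0 \<le> m x"
  by (simp add: less_imp_le)

lemma m_nonzero [simp]: "m x \<noteq> 0"
  using m_pos[of x] by linarith

lemma l2_iff: "f \<in> l2 m \<longleftrightarrow> (\<lambda>x. (f x * sqrt (m x))\<^sup>2) summable_on UNIV"
  by (simp add: l2_def power_mult_distrib)

lemma coord_to_ell2: "f \<in> l2 m \<Longrightarrow> coord (to_ell2 m f) x = f x * sqrt (m x)"
  by (simp add: to_ell2_def Abs_ell2_inverse l2_iff)

lemma of_ell2_in_l2 [simp]: "of_ell2 m h \<in> l2 m"
  using coord_square_summable[of h] by (simp add: l2_iff of_ell2_def)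

lemma of_to_ell2 [simp]: "f \<in> l2 m \<Longrightarrow> of_ell2 m (to_ell2 m f) = f"
  by (simp add: fun_eq_iff of_ell2_def coord_to_ell2)

lemma to_of_ell2 [simp]: "to_ell2 m (of_ell2 m h) = h"
  by (rule ell2_eqI) (simp add: coord_to_ell2 of_ell2_def)

lemma inner_to_ell2: "f \<in> l2 m \<Longrightarrow> g \<in> l2 m \<Longrightarrow> inner (to_ell2 m f) (to_ell2 m g) = l2_inner m f g"
  unfolding inner_ell2_def l2_inner_def
  by (rule infsum_cong) (simp add: coord_to_ell2 mult_ac)

lemma norm_to_ell2: "f \<in> l2 m \<Longrightarrow> norm (to_ell2 m f) = l2_norm m f"
  by (simp add: norm_eq_sqrt_inner inner_to_ell2 l2_norm_def)

lemma of_ell2_combine: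
  "of_ell2 m (\<alpha> *\<^sub>R g + \<beta> *\<^sub>R h) = (\<lambda>x. \<alpha> * of_ell2 m g x + \<beta> * of_ell2 m h x)"
  by (simp add: fun_eq_iff of_ell2_def add_divide_distrib)

lemma l2_combine: "f \<in> l2 m \<Longrightarrow> g \<in> l2 m \<Longrightarrow> (\<lambda>x. \<alpha> * f x + \<beta> * g x) \<in> l2 m"
  using of_ell2_in_l2[of "\<alpha> *\<^sub>R to_ell2 m f + \<beta> *\<^sub>R to_ell2 m g"]
  by (simp add: of_ell2_combine)

lemma to_ell2_combine:
  "f \<in> l2 m \<Longrightarrow> g \<in> l2 m \<Longrightarrow>
    to_ell2 m (\<lambda>x. \<alpha> * f x + \<beta> * g x) = \<alpha> *\<^sub>R to_ell2 m f + \<beta> *\<^sub>R to_ell2 m g"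
  using to_of_ell2[of "\<alpha> *\<^sub>R to_ell2 m f + \<beta> *\<^sub>R to_ell2 m g", unfolded of_ell2_combine]
  by simp

lemma l2_diff: "f \<in> l2 m \<Longrightarrow> g \<in> l2 m \<Longrightarrow> (\<lambda>x. f x - g x) \<in> l2 m"
  using l2_combine[of f g 1 "-1"] by simp

lemma to_ell2_diff:
  "f \<in> l2 m \<Longrightarrow> g \<in> l2 m \<Longrightarrow> to_ell2 m (\<lambda>x. f x - g x) = to_ell2 m f - to_ell2 m g"
  using to_ell2_combine[of f g 1 "-1"] by simp

lemma to_ell2_uminus: "f \<in> l2 m \<Longrightarrow> to_ell2 m (\<lambda>x. - f x) = - to_ell2 m f"
  using to_ell2_combine[of f f "-1" 0] by simp

lemma Cc_in_l2: "f \<in> Cc \<Longrightarrow> f \<in> l2 m"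
  unfolding l2_def Cc_def mem_Collect_eq
  by (rule finite_nonzero_values_imp_summable_on) (erule rev_finite_subset, auto)

lemma indicator_in_l2: "indicator {x} \<in> l2 m"
  by (rule Cc_in_l2) (simp add: Cc_def indicator_def)

lemma l2_inner_Cc:
  assumes "finite A" "{x. g x \<noteq> 0} \<subseteq> A"
  shows "l2_inner m f g = (\<Sum>x\<in>A. f x * g x * m x)"
proof -
  have "l2_inner m f g = (\<Sum>\<^sub>\<infinity>x\<in>A. f x * g x * m x)"
    unfolding l2_inner_def by (rule infsum_cong_neutral) (use assms(2) in auto)
  then show ?thesis
    using assms(1) by simp
qed

end

lemma Cc_diff: "f \<in> Cc \<Longrightarrow> g \<in> Cc \<Longrightarrow> (\<lambda>x. f x - g x) \<in> Cc"
  unfolding Cc_def mem_Collect_eq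
  by (rule finite_subset[of _ "{x. f x \<noteq> 0} \<union> {x. g x \<noteq> 0}"]) auto

lemma Cc_uminus: "f \<in> Cc \<Longrightarrow> (\<lambda>x. - f x) \<in> Cc"
  by (simp add: Cc_def)

lemma Cc_compose: "f \<in> Cc \<Longrightarrow> T 0 = 0 \<Longrightarrow> (\<lambda>x. T (f x)) \<in> Cc"
  unfolding Cc_def mem_Collect_eq by (erule rev_finite_subset) auto

lemma Cc_bounded:
  assumes "f \<in> Cc"
  obtains K where "0 \<le> K" "\<And>x. \<bar>f x\<bar> \<le> K"
proof
  show "\<bar>f x\<bar> \<le> (\<Sum>y | f y \<noteq> 0. \<bar>f y\<bar>)" for x
    using assms by (cases "f x = 0") (auto simp: Cc_def sum_nonneg intro!: member_le_sum)
qed (simp add: sum_nonneg)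


section \<open>The excess of a square summable function over a profile\<close>

text \<open>For the profile \<open>c * sqrt (m x)\<close>, the constant \<open>c\<close> in weighted
  coordinates, this is the image of (f - c)^+. A profile need not be square summable: if it is
  nonnegative, the positive part is at most \<open>\<bar>coord h x\<bar>\<close>.\<close>

definition excess :: "('a \<Rightarrow> real) \<Rightarrow> 'a ell2 \<Rightarrow> 'a ell2" where
  "excess a h = Abs_ell2 (\<lambda>x. max (coord h x - a x) 0)"

lemma coord_excess:
  assumes "\<And>x. 0 \<le> a x"
  shows "coord (excess a h) x = max (coord h x - a x) 0"
proof -
  have "(\<lambda>x. (max (coord h x - a x) 0)\<^sup>2) summable_on UNIV"
  proof (rule summable_on_comparison_test[OF coord_square_summable[of h]])
    show "(max (coord h x - a x) 0)\<^sup>2 \<le> (coord h x)\<^sup>2" for x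
      by (rule abs_le_square_iff[THEN iffD1]) (use assms[of x] in auto)
  qed auto
  then show ?thesis
    by (simp add: excess_def Abs_ell2_inverse)
qed

lemma norm_ell2_mono:
  assumes "\<And>x. \<bar>coord g x\<bar> \<le> \<bar>coord h x\<bar>"
  shows "norm g \<le> norm h"
proof -
  have "(norm g)\<^sup>2 \<le> (norm h)\<^sup>2"
    unfolding norm_ell2_square
    by (intro infsum_mono coord_square_summable) (use assms in \<open>simp add: abs_le_square_iff\<close>)
  then show ?thesis
    by (rule power2_le_imp_le) simp
qed

lemma excess_lipschitz:
  assumes "\<And>x. 0 \<le> a x"
  shows "norm (excess a g - excess a h) \<le> norm (g - h)"
  by (rule norm_ell2_mono) (auto simp: coord_excess[OF assms])

text \<open>In each coordinate s -> (s^+)^2 has derivative 2 s^+, with a first-order remainder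
  between 0 and the squared increment. Summation keeps this bound, and a quadratic remainder yields
  the Frechet derivative.\<close>

lemma norm_excess_expansion:
  assumes a: "\<And>x. 0 \<le> a x"
  shows "\<bar>(norm (excess a k))\<^sup>2 - (norm (excess a h))\<^sup>2 - 2 * inner (excess a h) (k - h)\<bar>
    \<le> (norm (k - h))\<^sup>2"
proof -
  let ?p = "coord (excess a k)" and ?q = "coord (excess a h)"
  let ?d = "\<lambda>x. (?p x)\<^sup>2 - (?q x)\<^sup>2 - 2 * (?q x * coord (k - h) x)"
  have "((\<lambda>x. (?p x)\<^sup>2 + - (?q x)\<^sup>2 + - 2 * (?q x * coord (k - h) x)) has_sum
      ((norm (excess a k))\<^sup>2 + - (norm (excess a h))\<^sup>2 + - 2 * inner (excess a h) (k - h))) UNIV"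
    unfolding norm_ell2_square inner_ell2_def
    by (intro has_sum_add has_sum_uminus[THEN iffD2] has_sum_cmult_right has_sum_infsum
        coord_square_summable coord_mult_summable)
      (simp add: has_sum_infsum coord_square_summable)
  then have hs: "(?d has_sum ((norm (excess a k))\<^sup>2 - (norm (excess a h))\<^sup>2
      - 2 * inner (excess a h) (k - h))) UNIV"
    by simp
  have d: "0 \<le> ?d x" "?d x \<le> (coord (k - h) x)\<^sup>2" for x
  proof -
    define u v where "u = coord k x - a x" and "v = coord h x - a x"
    have "?d x = (max u 0)\<^sup>2 - (max v 0)\<^sup>2 - 2 * (max v 0 * (u - v))"
      by (simp add: coord_excess[OF a] u_def v_def)
    moreover have "coord (k - h) x = u - v"
      by (simp add: u_def v_def)
    moreover have "0 \<le> (max u 0)\<^sup>2 - (max v 0)\<^sup>2 - 2 * (max v 0 * (u - v)) \<and>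
        (max u 0)\<^sup>2 - (max v 0)\<^sup>2 - 2 * (max v 0 * (u - v)) \<le> (u - v)\<^sup>2"
    proof (cases "0 \<le> u"; cases "0 \<le> v")
      assume "0 \<le> u" "0 \<le> v"
      then show ?thesis
        using zero_le_power2[of "u - v"] by (simp add: power2_eq_square algebra_simps)
    next
      assume "0 \<le> u" "\<not> 0 \<le> v"
      then show ?thesis
        using mult_nonneg_nonpos[of u v] zero_le_square[of v] zero_le_square[of u] by (simp add: power2_eq_square algebra_simps)
    next
      assume "\<not> 0 \<le> u" "0 \<le> v"
      then have "u * (v * 2) \<le> 0"
        by (simp add: mult_le_0_iff)
      then have "u * (v * 2) \<le> v * v"
        using zero_le_square[of v] by linarith
      then show ?thesis
        using \<open>\<not> 0 \<le> u\<close> \<open>0 \<le> v\<close> by (simp add: power2_eq_square algebra_simps)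
    qed simp
    ultimately show "0 \<le> ?d x" "?d x \<le> (coord (k - h) x)\<^sup>2"
      by simp_all
  qed
  have "((\<lambda>x. (coord (k - h) x)\<^sup>2) has_sum (norm (k - h))\<^sup>2) UNIV"
    unfolding norm_ell2_square by (intro has_sum_infsum coord_square_summable)
  then show ?thesis
    using has_sum_mono[OF hs _ d(2)] has_sum_nonneg[OF hs d(1)] by simp
qed

lemma has_derivative_norm_excess:
  assumes a: "\<And>x. 0 \<le> a x"
  shows "((\<lambda>h. (norm (excess a h))\<^sup>2) has_derivative (\<lambda>k. 2 * inner (excess a h) k)) (at h)"
proof -
  have lim: "((\<lambda>k. norm (k - h)) \<longlongrightarrow> 0) (at h)"
    by (intro tendsto_eq_intros) auto
  have "((\<lambda>k. norm ((norm (excess a k))\<^sup>2 - (norm (excess a h))\<^sup>2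
      - 2 * inner (excess a h) (k - h)) / norm (k - h)) \<longlongrightarrow> 0) (at h)"
  proof (rule tendsto_sandwich[OF _ _ tendsto_const lim])
    show "\<forall>\<^sub>F k in at h. norm ((norm (excess a k))\<^sup>2 - (norm (excess a h))\<^sup>2
        - 2 * inner (excess a h) (k - h)) / norm (k - h) \<le> norm (k - h)"
      unfolding eventually_at_filter
    proof (intro always_eventually allI impI)
      fix k assume "k \<noteq> h"
      then show "norm ((norm (excess a k))\<^sup>2 - (norm (excess a h))\<^sup>2
        - 2 * inner (excess a h) (k - h)) / norm (k - h) \<le> norm (k - h)"
        using norm_excess_expansion[of a k h, OF a]
        by (simp add: pos_divide_le_eq power2_eq_square)
    qed
  qed simp
  then show ?thesis
    unfolding has_derivative_iff_norm
    by (auto intro!: bounded_linear_intros)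
qed


section \<open>The quadratic form of a locally finite graph\<close>

locale weighted_graph = discrete_measure_space m
  for b :: "'a::countable \<Rightarrow> 'a \<Rightarrow> real" and m :: "'a \<Rightarrow> real" +
  assumes graph: "locally_finite_graph b"
begin

lemma b_nonneg [simp]: "0 \<le> b x y"
  and b_sym: "b x y = b y x"
  and finite_neighbours [simp]: "finite {y. 0 < b x y}"
  using graph by (auto simp: locally_finite_graph_def)

text \<open>It contains both ends of every edge on which a function supported in \<open>S\<close>
  varies, and outside it sums over neighbours do not see \<open>S\<close>.\<close>

definition ball1 :: "'a set \<Rightarrow> 'a set" where
  "ball1 S = S \<union> (\<Union>x\<in>S. {y. 0 < b x y})"

lemma finite_ball1: "finite S \<Longrightarrow> finite (ball1 S)"
  by (simp add: ball1_def)

lemma neighbour_notin: "x \<notin> ball1 S \<Longrightarrow> 0 < b x y \<Longrightarrow> y \<notin> S"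
  using b_sym by (auto simp: ball1_def)

lemma sum_neighbours:
  assumes "finite A" "{y. 0 < b x y} \<subseteq> A"
  shows "(\<Sum>y | 0 < b x y. b x y * g y) = (\<Sum>y\<in>A. b x y * g y)"
proof (rule sum.mono_neutral_left[OF assms])
  show "\<forall>y\<in>A - {y. 0 < b x y}. b x y * g y = 0"
    using b_nonneg by (auto simp: not_less intro: antisym)
qed

lemma laplacian_Cc:
  assumes "f \<in> Cc"
  shows "laplacian b m f \<in> Cc"
proof -
  have "laplacian b m f x = 0" if x: "x \<notin> ball1 {x. f x \<noteq> 0}" for x
  proof -
    have "f x = 0"
      using x by (auto simp: ball1_def)
    moreover have "f y = 0" if "0 < b x y" for y
      using neighbour_notin[OF x that] by simp
    ultimately show ?thesis
      by (auto simp: laplacian_def intro!: sum.neutral)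
  qed
  then have "{x. laplacian b m f x \<noteq> 0} \<subseteq> ball1 {x. f x \<noteq> 0}"
    by blast
  then show ?thesis
    using assms finite_ball1 unfolding Cc_def by (auto intro: finite_subset)
qed

abbreviation energy :: "('a \<Rightarrow> real) \<Rightarrow> ('a \<Rightarrow> real) \<Rightarrow> real" where
  "energy f g \<equiv> l2_inner m (\<lambda>x. - laplacian b m f x) g"

text \<open>The Dirichlet form restricted to \<open>A\<close>; halving compensates that each edge
  occurs in both orientations. As a finite sum it lets inequalities be checked edge by edge.\<close>

definition energy_on :: "'a set \<Rightarrow> ('a \<Rightarrow> real) \<Rightarrow> ('a \<Rightarrow> real) \<Rightarrow> real" where
  "energy_on A f g = (\<Sum>x\<in>A. \<Sum>y\<in>A. b x y * ((f x - f y) * (g x - g y))) / 2"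

text \<open>Summation by parts. Every edge on which \<open>g\<close> varies has both ends in
  \<open>ball1 S\<close>, so a finite double sum captures the pairing with an arbitrary
  \<open>f\<close>.\<close>

lemma green:
  assumes S: "finite S" "{x. g x \<noteq> 0} \<subseteq> S"
  shows "energy f g = energy_on (ball1 S) f g"
proof -
  let ?A = "ball1 S"
  have fin: "finite ?A"
    by (rule finite_ball1[OF S(1)])
  have "energy f g = (\<Sum>x\<in>?A. - laplacian b m f x * g x * m x)"
    by (rule l2_inner_Cc[OF fin]) (use S(2) in \<open>auto simp: ball1_def\<close>)
  also have "\<dots> = (\<Sum>x\<in>?A. \<Sum>y\<in>?A. b x y * ((f x - f y) * g x))"
  proof (rule sum.cong[OF refl])
    fix x assume "x \<in> ?A"
    show "- laplacian b m f x * g x * m x = (\<Sum>y\<in>?A. b x y * ((f x - f y) * g x))"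
    proof (cases "g x = 0")
      case False
      then have "x \<in> S" using S(2) by blast
      then have "{y. 0 < b x y} \<subseteq> ?A" by (auto simp: ball1_def)
      then have "laplacian b m f x = 1 / m x * (\<Sum>y\<in>?A. b x y * (f y - f x))"
        unfolding laplacian_def by (simp add: sum_neighbours[OF fin, where g="\<lambda>y. f y - f x"])
      then have "- laplacian b m f x * g x * m x = - (\<Sum>y\<in>?A. b x y * (f y - f x)) * g x"
        by simp
      also have "\<dots> = (\<Sum>y\<in>?A. b x y * ((f x - f y) * g x))"
        unfolding sum_negf[symmetric] sum_distrib_right
        by (intro sum.cong refl) (simp add: algebra_simps)
      finally show ?thesis .
    qed simp
  qed
  also have "\<dots> = energy_on ?A f g"
  proof -
    let ?s = "\<Sum>x\<in>?A. \<Sum>y\<in>?A. b x y * ((f x - f y) * g x)"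
    \<comment> \<open>Exchanging the ends of every edge and averaging turns \<open>g x\<close> into
      half of \<open>g x - g y\<close>.\<close>
    have "?s = (\<Sum>y\<in>?A. \<Sum>x\<in>?A. b x y * ((f x - f y) * g x))"
      by (rule sum.swap)
    also have "\<dots> = (\<Sum>x\<in>?A. \<Sum>y\<in>?A. b x y * ((f y - f x) * g y))"
      using b_sym by simp
    finally have "?s + ?s = (\<Sum>x\<in>?A. \<Sum>y\<in>?A. b x y * ((f x - f y) * g x)
        + b x y * ((f y - f x) * g y))"
      by (simp add: sum.distrib)
    also have "\<dots> = (\<Sum>x\<in>?A. \<Sum>y\<in>?A. b x y * ((f x - f y) * (g x - g y)))"
      by (intro sum.cong refl) (simp add: algebra_simps)
    finally show ?thesis
      by (simp add: energy_on_def)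
  qed
  finally show ?thesis .
qed

lemma energy_sym:
  assumes "f \<in> Cc" "g \<in> Cc"
  shows "energy f g = energy g f"
proof -
  let ?S = "{x. f x \<noteq> 0} \<union> {x. g x \<noteq> 0}"
  have "finite ?S" using assms by (simp add: Cc_def)
  then show ?thesis
    by (subst (1 2) green[of ?S]) (auto simp: energy_on_def mult.commute)
qed

lemma energy_nonneg:
  assumes "f \<in> Cc"
  shows "0 \<le> energy f f"
  using assms by (subst green[of "{x. f x \<noteq> 0}"])
    (auto simp: Cc_def energy_on_def intro!: sum_nonneg)

lemma energy_diff_left:
  assumes "g \<in> Cc"
  shows "energy (\<lambda>x. f x - f' x) g = energy f g - energy f' g"
  using assms by (subst (1 2 3) green[of "{x. g x \<noteq> 0}"])
    (auto simp: Cc_def energy_on_def sum_subtractf[symmetric] diff_divide_distrib[symmetric]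
      algebra_simps)

lemma energy_diff_right:
  assumes "f \<in> Cc" "g \<in> Cc" "g' \<in> Cc"
  shows "energy f (\<lambda>x. g x - g' x) = energy f g - energy f g'"
  using assms by (simp add: energy_sym[of f] Cc_diff energy_diff_left)

text \<open>Young's inequality on each edge stands in for Cauchy-Schwarz; the free weight
  \<open>e\<close> later balances a small energy against a bounded one.\<close>

lemma energy_young:
  assumes "f \<in> Cc" "g \<in> Cc" and e: "0 < e"
  shows "\<bar>energy f g\<bar> \<le> (energy f f / e + e * energy g g) / 2"
proof -
  let ?S = "{x. f x \<noteq> 0} \<union> {x. g x \<noteq> 0}"
  let ?A = "ball1 ?S"
  have fin: "finite ?S" using assms by (simp add: Cc_def)
  have *: "energy f f = energy_on ?A f f" "energy g g = energy_on ?A g g"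
    "energy f g = energy_on ?A f g"
    by (rule green[OF fin]; auto)+
  have y: "\<bar>u * v\<bar> \<le> (u * u / e + e * (v * v)) / 2" for u v :: real
  proof -
    have "0 \<le> (\<bar>u\<bar> - e * \<bar>v\<bar>)\<^sup>2 / e"
      using e by simp
    then show ?thesis
      using e by (simp add: power2_eq_square field_simps abs_mult)
  qed
  have "\<bar>energy_on ?A f g\<bar> \<le> (\<Sum>x\<in>?A. \<Sum>y\<in>?A. b x y * \<bar>(f x - f y) * (g x - g y)\<bar>) / 2"
    unfolding energy_on_def abs_divide
    by (auto simp: abs_mult intro!: divide_right_mono sum_abs[THEN order_trans] sum_mono)
  also have "\<dots> \<le> (\<Sum>x\<in>?A. \<Sum>y\<in>?A. b x y * (((f x - f y) * (f x - f y) / e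
      + e * ((g x - g y) * (g x - g y))) / 2)) / 2"
    by (intro divide_right_mono sum_mono mult_left_mono y) auto
  also have "\<dots> = (energy_on ?A f f / e + e * energy_on ?A g g) / 2"
    unfolding energy_on_def sum_divide_distrib sum_distrib_left sum.distrib[symmetric]
    by (intro sum.cong refl) (use e in \<open>simp add: field_simps\<close>)
  finally show ?thesis
    by (simp add: *)
qed

text \<open>Along a sequence that is Cauchy for the form, this bounds all late energies by that of a
  single member.\<close>

lemma energy_diff_le:
  assumes "f \<in> Cc" "g \<in> Cc"
  shows "energy f f \<le> 2 * energy g g + 2 * energy (\<lambda>x. f x - g x) (\<lambda>x. f x - g x)"
proof -
  have d: "(\<lambda>x. f x - g x) \<in> Cc"
    by (rule Cc_diff[OF assms])
  have "energy (\<lambda>x. f x - g x) (\<lambda>x. f x - g x) = energy f f - 2 * energy f g + energy g g"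
    using assms d by (simp add: energy_diff_left energy_diff_right energy_sym[of g f])
  moreover have "\<bar>energy f g\<bar> \<le> (energy f f / 2 + 2 * energy g g) / 2"
    by (rule energy_young[OF assms]) simp
  ultimately show ?thesis
    by argo
qed

text \<open>With \<open>p\<close>, \<open>p'\<close>, \<open>s\<close> the differences of \<open>f\<close>, \<open>f'\<close> and the truncation along an edge,
  \<open>p * s \<ge> s\<^sup>2\<close> gives \<open>p' * s \<ge> s\<^sup>2 + (p' - p) * s \<ge> - (p' - p)\<^sup>2 / 4\<close>.\<close>

lemma energy_truncation:
  assumes f: "f \<in> Cc" "f' \<in> Cc" and c: "0 \<le> c"
  shows "- energy (\<lambda>x. f' x - f x) (\<lambda>x. f' x - f x) / 4 \<le> energy f' (\<lambda>x. max (f x - c) 0)"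
proof -
  let ?S = "{x. f x \<noteq> 0} \<union> {x. f' x \<noteq> 0}"
  let ?A = "ball1 ?S"
  have fin: "finite ?S" using f by (simp add: Cc_def)
  have *: "energy (\<lambda>x. f' x - f x) (\<lambda>x. f' x - f x) = energy_on ?A (\<lambda>x. f' x - f x) (\<lambda>x. f' x - f x)"
    "energy f' (\<lambda>x. max (f x - c) 0) = energy_on ?A f' (\<lambda>x. max (f x - c) 0)"
    by (rule green[OF fin]; use c in auto)+
  have edge: "- (((f' x - f x) - (f' y - f y)) * ((f' x - f x) - (f' y - f y))) / 4 \<le>
      (f' x - f' y) * (max (f x - c) 0 - max (f y - c) 0)" for x y
  proof -
    define p p' s where "p = f x - f y" and "p' = f' x - f' y"
      and "s = max (f x - c) 0 - max (f y - c) 0"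
    have "s * s \<le> p * s"
    proof (cases "f y \<le> f x")
      case True
      then have "0 \<le> s" "s \<le> p" by (auto simp: s_def p_def)
      then show ?thesis by (rule mult_right_mono[rotated])
    next
      case False
      then have "s \<le> 0" "p \<le> s" by (auto simp: s_def p_def)
      then show ?thesis by (rule mult_right_mono_neg[rotated])
    qed
    moreover have "0 \<le> (s + (p' - p) / 2)\<^sup>2"
      by simp
    ultimately have "- ((p' - p) * (p' - p)) / 4 \<le> p' * s"
      by (simp add: power2_eq_square field_simps)
    moreover have eq: "(f' x - f x) - (f' y - f y) = p' - p"
      by (simp add: p_def p'_def)
    ultimately show ?thesis
      unfolding eq s_def[symmetric] p'_def[symmetric] by simp
  qed
  have "- energy_on ?A (\<lambda>x. f' x - f x) (\<lambda>x. f' x - f x) / 4 =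
      (\<Sum>x\<in>?A. \<Sum>y\<in>?A. b x y * (- (((f' x - f x) - (f' y - f y)) * ((f' x - f x) - (f' y - f y))) / 4)) / 2"
    by (simp add: energy_on_def sum_divide_distrib sum_negf)
  also have "\<dots> \<le> energy_on ?A f' (\<lambda>x. max (f x - c) 0)"
    unfolding energy_on_def by (intro divide_right_mono sum_mono mult_left_mono edge) auto
  finally show ?thesis
    by (simp add: *)
qed

end

section \<open>The closed form and the action of its operator\<close>

context weighted_graph
begin

abbreviation form_conv :: "(nat \<Rightarrow> 'a \<Rightarrow> real) \<Rightarrow> ('a \<Rightarrow> real) \<Rightarrow> bool" where
  "form_conv \<equiv> form_converges m Cc (\<lambda>f x. - laplacian b m f x)"

lemma form_convD:
  assumes "form_conv \<phi> f"
  shows "f \<in> l2 m" "\<phi> n \<in> Cc" "(\<lambda>n. to_ell2 m (\<phi> n)) \<longlonglongrightarrow> to_ell2 m f"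
    "0 < e \<Longrightarrow> \<exists>N. \<forall>i\<ge>N. \<forall>j\<ge>N. energy (\<lambda>x. \<phi> i x - \<phi> j x) (\<lambda>x. \<phi> i x - \<phi> j x) < e"
proof -
  show f: "f \<in> l2 m" and \<phi>: "\<phi> n \<in> Cc" for n
    using assms by (auto simp: form_converges_def)
  have "(\<lambda>n. norm (to_ell2 m (\<phi> n) - to_ell2 m f)) \<longlonglongrightarrow> 0"
    using assms f \<phi>
    by (simp add: form_converges_def to_ell2_diff[symmetric] norm_to_ell2 l2_diff Cc_in_l2)
  then show "(\<lambda>n. to_ell2 m (\<phi> n)) \<longlonglongrightarrow> to_ell2 m f"
    by (rule LIM_zero_cancel[OF tendsto_norm_zero_cancel])
  show "0 < e \<Longrightarrow> \<exists>N. \<forall>i\<ge>N. \<forall>j\<ge>N. energy (\<lambda>x. \<phi> i x - \<phi> j x) (\<lambda>x. \<phi> i x - \<phi> j x) < e"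
    using assms unfolding form_converges_def by blast
qed

lemma form_conv_const: "f \<in> Cc \<Longrightarrow> form_conv (\<lambda>_. f) f"
  by (simp add: form_converges_def Cc_in_l2 l2_norm_def l2_inner_def)

lemma energy_eq_inner:
  assumes "f \<in> Cc" "g \<in> l2 m"
  shows "energy f g = inner (to_ell2 m (\<lambda>x. - laplacian b m f x)) (to_ell2 m g)"
  using assms by (simp add: inner_to_ell2 Cc_in_l2 Cc_uminus laplacian_Cc)

text \<open>Closability of the form at \<open>f\<close>.\<close>

lemma energy_tendsto_0:
  assumes f: "f \<in> Cc" and \<phi>: "form_conv \<phi> f"
  shows "(\<lambda>n. energy (\<lambda>x. \<phi> n x - f x) (\<lambda>x. \<phi> n x - f x)) \<longlonglongrightarrow> 0"
proof (rule LIMSEQ_I)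
  fix e :: real assume e: "0 < e"
  define \<xi> where "\<xi> n = (\<lambda>x. \<phi> n x - f x)" for n
  note \<phi>C = form_convD(2)[OF \<phi>]
  have \<xi>C: "\<xi> n \<in> Cc" for n
    unfolding \<xi>_def by (intro Cc_diff \<phi>C f)
  obtain N where N: "\<And>i j. i \<ge> N \<Longrightarrow> j \<ge> N \<Longrightarrow>
      energy (\<lambda>x. \<phi> i x - \<phi> j x) (\<lambda>x. \<phi> i x - \<phi> j x) < e / 2"
    using form_convD(4)[OF \<phi>, of "e / 2"] e by auto
  have "(\<lambda>k. to_ell2 m (\<xi> k)) \<longlonglongrightarrow> to_ell2 m f - to_ell2 m f"
    unfolding \<xi>_def using form_convD(3)[OF \<phi>]
    by (simp add: to_ell2_diff Cc_in_l2 \<phi>C f LIM_zero)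
  \<comment> \<open>For fixed \<open>n\<close> this is an inner product with the fixed vector
    -\<Delta> \<open>\<xi> n\<close>, so convergence of \<open>\<xi> k\<close> to 0 in l2
    suffices.\<close>
  then have lim: "(\<lambda>k. energy (\<xi> n) (\<xi> k)) \<longlonglongrightarrow> 0" for n
    using tendsto_inner[OF tendsto_const, of "\<lambda>k. to_ell2 m (\<xi> k)" 0 sequentially]
    by (simp add: energy_eq_inner \<xi>C Cc_in_l2)
  \<comment> \<open>Split the second argument \<open>\<xi> n\<close> into
    \<open>\<xi> n - \<xi> k\<close> and \<open>\<xi> k\<close>. Young absorbs half of the left-hand
    side, the Cauchy property makes the energy of the difference small, and the mixed term vanishes
    as \<open>k\<close> grows.\<close>
  have "energy (\<xi> n) (\<xi> n) \<le> e / 2" if "n \<ge> N" for n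
  proof (rule LIMSEQ_le_const[of "\<lambda>k. e / 2 + 2 * energy (\<xi> n) (\<xi> k)"])
    have "(\<lambda>k. e / 2 + 2 * energy (\<xi> n) (\<xi> k)) \<longlonglongrightarrow> e / 2 + 2 * 0"
      by (intro tendsto_intros lim)
    then show "(\<lambda>k. e / 2 + 2 * energy (\<xi> n) (\<xi> k)) \<longlonglongrightarrow> e / 2"
      by simp
    have "energy (\<xi> n) (\<xi> n) \<le> e / 2 + 2 * energy (\<xi> n) (\<xi> k)" if "k \<ge> N" for k
    proof -
      let ?d = "\<lambda>x. \<xi> n x - \<xi> k x"
      have "energy ?d ?d < e / 2"
        using N[OF \<open>n \<ge> N\<close> that] by (simp add: \<xi>_def)
      moreover have "\<bar>energy (\<xi> n) ?d\<bar> \<le> (energy (\<xi> n) (\<xi> n) / 1 + 1 * energy ?d ?d) / 2"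
        by (intro energy_young Cc_diff \<xi>C) simp
      moreover have "energy (\<xi> n) ?d = energy (\<xi> n) (\<xi> n) - energy (\<xi> n) (\<xi> k)"
        by (intro energy_diff_right \<xi>C)
      ultimately show ?thesis
        by argo
    qed
    then show "\<exists>N. \<forall>k\<ge>N. energy (\<xi> n) (\<xi> n) \<le> e / 2 + 2 * energy (\<xi> n) (\<xi> k)"
      by blast
  qed
  then have "norm (energy (\<xi> n) (\<xi> n) - 0) < e" if "n \<ge> N" for n
    using that e energy_nonneg[OF \<xi>C, of n] by fastforce
  then show "\<exists>N. \<forall>n\<ge>N. norm (energy (\<lambda>x. \<phi> n x - f x) (\<lambda>x. \<phi> n x - f x) - 0) < e"
    unfolding \<xi>_def by blast
qed

text \<open>The definition quantifies over all approximating sequences, so constant ones are not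
  enough. Split \<open>\<phi> n\<close> into \<open>f\<close> and an error: closability kills the
  error against the bounded energies of \<open>\<psi> n\<close>, and the part at \<open>f\<close>
  converges in l2.\<close>

lemma graph_operator_Cc:
  assumes f: "f \<in> Cc"
  shows "(f, \<lambda>x. - laplacian b m f x) \<in> graph_operator b m"
proof -
  have "(\<lambda>n. energy (\<phi> n) (\<psi> n)) \<longlonglongrightarrow> energy f h"
    if \<phi>: "form_conv \<phi> f" and \<psi>: "form_conv \<psi> h" for \<phi> \<psi> h
  proof -
    note \<phi>C = form_convD(2)[OF \<phi>] and \<psi>C = form_convD(2)[OF \<psi>]
    let ?\<xi> = "\<lambda>n x. \<phi> n x - f x"
    have \<xi>C: "?\<xi> n \<in> Cc" for n
      by (intro Cc_diff \<phi>C f)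
    obtain N where N: "\<And>i. i \<ge> N \<Longrightarrow>
        energy (\<lambda>x. \<psi> i x - \<psi> N x) (\<lambda>x. \<psi> i x - \<psi> N x) < 1"
      using form_convD(4)[OF \<psi>, of 1] by auto
    define K where "K = 2 * energy (\<psi> N) (\<psi> N) + 2"
    have K: "energy (\<psi> n) (\<psi> n) \<le> K" if "n \<ge> N" for n
      using energy_diff_le[OF \<psi>C \<psi>C, of n N] N[OF that] by (simp add: K_def)
    have K0: "0 < K"
      using energy_nonneg[OF \<psi>C, of N] by (simp add: K_def)
    have "(\<lambda>n. energy (?\<xi> n) (\<psi> n)) \<longlonglongrightarrow> 0"
    proof (rule LIMSEQ_I)
      fix e :: real assume e: "0 < e"
      obtain M where M: "\<And>n. n \<ge> M \<Longrightarrow> \<bar>energy (?\<xi> n) (?\<xi> n)\<bar> < e * (e / K)"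
        using LIMSEQ_D[OF energy_tendsto_0[OF f \<phi>], of "e * (e / K)"] e K0 by auto
      have "norm (energy (?\<xi> n) (\<psi> n) - 0) < e" if n: "n \<ge> max M N" for n
      proof -
        \<comment> \<open>The weight \<open>e / K\<close> makes both terms at most \<open>e\<close>,
          the first one strictly smaller.\<close>
        have "\<bar>energy (?\<xi> n) (\<psi> n)\<bar> \<le>
            (energy (?\<xi> n) (?\<xi> n) / (e / K) + e / K * energy (\<psi> n) (\<psi> n)) / 2"
          using e K0 by (intro energy_young \<xi>C \<psi>C) simp
        moreover have "e / K * energy (\<psi> n) (\<psi> n) \<le> e / K * K"
          using K[of n] n e K0 by (intro mult_left_mono) auto
        moreover have "energy (?\<xi> n) (?\<xi> n) / (e / K) < e"
          using M[of n] n e K0 by (subst pos_divide_less_eq) auto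
        ultimately show ?thesis
          using K0 by simp
      qed
      then show "\<exists>N. \<forall>n\<ge>N. norm (energy (?\<xi> n) (\<psi> n) - 0) < e"
        by blast
    qed
    moreover have "(\<lambda>n. energy f (\<psi> n)) \<longlonglongrightarrow> energy f h"
      using tendsto_inner[OF tendsto_const form_convD(3)[OF \<psi>]]
      by (simp add: energy_eq_inner f \<psi>C Cc_in_l2 form_convD(1)[OF \<psi>])
    ultimately have "(\<lambda>n. energy (?\<xi> n) (\<psi> n) + energy f (\<psi> n)) \<longlonglongrightarrow> 0 + energy f h"
      by (rule tendsto_add)
    then show ?thesis
      by (simp add: energy_diff_left \<psi>C)
  qed
  then show ?thesis
    unfolding graph_operator_def friedrichs_extension_def form_domain_def
    using form_conv_const[OF f]
    by (auto intro!: Cc_in_l2 Cc_uminus laplacian_Cc f)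
qed

lemma graph_operatorE:
  assumes "(f, g) \<in> graph_operator b m"
  obtains \<phi> where "g \<in> l2 m" "form_conv \<phi> f"
    "\<And>h. h \<in> Cc \<Longrightarrow> (\<lambda>n. energy (\<phi> n) h) \<longlonglongrightarrow> l2_inner m g h"
proof -
  obtain \<phi> where \<phi>: "form_conv \<phi> f"
    using assms unfolding graph_operator_def friedrichs_extension_def form_domain_def by auto
  moreover have "g \<in> l2 m"
    using assms unfolding graph_operator_def friedrichs_extension_def by auto
  moreover have "(\<lambda>n. energy (\<phi> n) h) \<longlonglongrightarrow> l2_inner m g h" if "h \<in> Cc" for h
    using assms \<phi> form_conv_const[OF that]
    unfolding graph_operator_def friedrichs_extension_def form_domain_def by fast
  ultimately show ?thesis
    using that by blast
qed

lemma l2_inner_indicator: "l2_inner m f (indicator {x}) = f x * m x"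
  by (subst l2_inner_Cc[of "{x}"]) (auto simp: indicator_def)

text \<open>Testing against the indicator of \<open>x\<close> localizes the weak equation, and as
  \<open>x\<close> has finitely many neighbours, pointwise convergence of the approximants passes
  through the Laplacian.\<close>

lemma graph_operator_eq_laplacian:
  assumes "(f, g) \<in> graph_operator b m"
  shows "g x = - laplacian b m f x"
proof -
  obtain \<phi> where \<phi>: "form_conv \<phi> f"
    "\<And>h. h \<in> Cc \<Longrightarrow> (\<lambda>n. energy (\<phi> n) h) \<longlonglongrightarrow> l2_inner m g h"
    using graph_operatorE[OF assms] by metis
  have pointwise: "(\<lambda>n. \<phi> n y) \<longlonglongrightarrow> f y" for y
  proof -
    have "(\<lambda>n. coord (to_ell2 m (\<phi> n)) y / sqrt (m y)) \<longlonglongrightarrow> coord (to_ell2 m f) y / sqrt (m y)"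
      by (intro tendsto_intros bounded_linear.tendsto[OF bounded_linear_coord] form_convD(3)[OF \<phi>(1)]) simp
    then show ?thesis
      by (simp add: coord_to_ell2 Cc_in_l2 form_convD[OF \<phi>(1)])
  qed
  have "(\<lambda>n. - laplacian b m (\<phi> n) x * m x) \<longlonglongrightarrow> - laplacian b m f x * m x"
    unfolding laplacian_def by (intro tendsto_intros pointwise)
  moreover have "(\<lambda>n. - laplacian b m (\<phi> n) x * m x) \<longlonglongrightarrow> g x * m x"
    using \<phi>(2)[of "indicator {x}"] by (simp add: l2_inner_indicator Cc_def indicator_def)
  ultimately have "- laplacian b m f x * m x = g x * m x"
    by (rule LIMSEQ_unique)
  then have "- laplacian b m f x = g x"
    by (simp only: mult_right_cancel[OF m_nonzero])
  then show ?thesis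
    by simp
qed

text \<open>This avoids placing (f - c)^+ in the form domain. The truncated approximants
  \<open>\<psi> k\<close> are admissible test functions. First \<open>n\<close> grows with
  \<open>k\<close> fixed, the loss being a quarter of the energy of
  \<open>\<phi> n - \<phi> k\<close>; then l2 convergence of \<open>\<psi> k\<close> is
  enough.\<close>

lemma graph_operator_excess:
  assumes "(f, g) \<in> graph_operator b m" and c: "0 \<le> c"
  shows "0 \<le> inner (to_ell2 m g) (excess (\<lambda>x. c * sqrt (m x)) (to_ell2 m f))"
proof -
  let ?a = "\<lambda>x. c * sqrt (m x)"
  obtain \<phi> where g: "g \<in> l2 m" and \<phi>: "form_conv \<phi> f"
    and lim: "\<And>h. h \<in> Cc \<Longrightarrow> (\<lambda>n. energy (\<phi> n) h) \<longlonglongrightarrow> l2_inner m g h"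
    using graph_operatorE[OF assms(1)] by metis
  note \<phi>C = form_convD(2)[OF \<phi>]
  define \<psi> where "\<psi> k = (\<lambda>x. max (\<phi> k x - c) 0)" for k
  have \<psi>C: "\<psi> k \<in> Cc" for k
    unfolding \<psi>_def by (rule Cc_compose[OF \<phi>C, of "\<lambda>s. max (s - c) 0"]) (use c in simp)
  have a: "0 \<le> ?a x" for x
    using c by simp
  have to_\<psi>: "to_ell2 m (\<psi> k) = excess ?a (to_ell2 m (\<phi> k))" for k
  proof (rule ell2_eqI)
    fix x
    have "max (u * r - c * r) 0 = max (u - c) 0 * r" if "0 \<le> r" for u r :: real
      using that by (simp add: max_mult_distrib_right left_diff_distrib)
    then show "coord (to_ell2 m (\<psi> k)) x = coord (excess ?a (to_ell2 m (\<phi> k))) x"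
      by (simp add: coord_excess a coord_to_ell2 Cc_in_l2 \<phi>C \<psi>C) (simp add: \<psi>_def)
  qed
  have "(\<lambda>k. excess ?a (to_ell2 m (\<phi> k))) \<longlonglongrightarrow> excess ?a (to_ell2 m f)"
  proof (rule LIM_zero_cancel, rule Lim_null_comparison)
    show "(\<lambda>k. norm (to_ell2 m (\<phi> k) - to_ell2 m f)) \<longlonglongrightarrow> 0"
      using form_convD(3)[OF \<phi>] by (intro tendsto_norm_zero LIM_zero)
  qed (intro always_eventually allI excess_lipschitz a)
  then have lim\<psi>: "(\<lambda>k. l2_inner m g (\<psi> k)) \<longlonglongrightarrow> inner (to_ell2 m g) (excess ?a (to_ell2 m f))"
    using tendsto_inner[OF tendsto_const]
    by (simp add: inner_to_ell2[symmetric] g \<psi>C Cc_in_l2 to_\<psi>)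
  have ge: "- e \<le> inner (to_ell2 m g) (excess ?a (to_ell2 m f))" if e: "0 < e" for e
  proof (rule LIMSEQ_le_const[OF lim\<psi>])
    obtain N where N: "\<And>i j. i \<ge> N \<Longrightarrow> j \<ge> N \<Longrightarrow>
        energy (\<lambda>x. \<phi> i x - \<phi> j x) (\<lambda>x. \<phi> i x - \<phi> j x) < e"
      using form_convD(4)[OF \<phi> e] by auto
    have "- e \<le> l2_inner m g (\<psi> k)" if "k \<ge> N" for k
    proof (rule LIMSEQ_le_const[OF lim[OF \<psi>C]])
      have "- e \<le> energy (\<phi> n) (\<psi> k)" if "n \<ge> N" for n
        using energy_truncation[OF \<phi>C \<phi>C c, of n k] N[OF that \<open>k \<ge> N\<close>] e
          energy_nonneg[OF Cc_diff[OF \<phi>C \<phi>C], of n k]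
        unfolding \<psi>_def by linarith
      then show "\<exists>N. \<forall>n\<ge>N. - e \<le> energy (\<phi> n) (\<psi> k)"
        by blast
    qed
    then show "\<exists>N. \<forall>k\<ge>N. - e \<le> l2_inner m g (\<psi> k)"
      by blast
  qed
  show ?thesis
  proof (rule field_le_epsilon)
    fix e :: real assume "0 < e"
    then show "0 \<le> inner (to_ell2 m g) (excess ?a (to_ell2 m f)) + e"
      using ge[of e] by linarith
  qed
qed

end


section \<open>The heat semigroup on finitely supported functions\<close>

locale heat_flow = weighted_graph b m
  for b :: "'a::countable \<Rightarrow> 'a \<Rightarrow> real" and m :: "'a \<Rightarrow> real" +
  fixes P :: "real \<Rightarrow> ('a \<Rightarrow> real) \<Rightarrow> 'a \<Rightarrow> real"
  assumes heat: "heat_semigroup b m P"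
begin

lemma P_l2: "0 \<le> t \<Longrightarrow> f \<in> l2 m \<Longrightarrow> P t f \<in> l2 m"
  and P_linear: "0 \<le> t \<Longrightarrow> f \<in> l2 m \<Longrightarrow> g \<in> l2 m \<Longrightarrow>
    P t (\<lambda>x. \<alpha> * f x + \<beta> * g x) = (\<lambda>x. \<alpha> * P t f x + \<beta> * P t g x)"
  and P_bounded: "0 \<le> t \<Longrightarrow> \<exists>M. \<forall>f\<in>l2 m. l2_norm m (P t f) \<le> M * l2_norm m f"
  and P_0: "f \<in> l2 m \<Longrightarrow> P 0 f = f"
  and P_add: "0 \<le> s \<Longrightarrow> 0 \<le> t \<Longrightarrow> f \<in> l2 m \<Longrightarrow> P (s + t) f = P s (P t f)"
  and P_right_continuous: "f \<in> l2 m \<Longrightarrow>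
    ((\<lambda>t. l2_norm m (\<lambda>x. P t f x - f x)) \<longlongrightarrow> 0) (at_right 0)"
  using heat unfolding heat_semigroup_def l2_C0_semigroup_def by auto

definition S :: "real \<Rightarrow> 'a ell2 \<Rightarrow> 'a ell2" where
  "S t h = to_ell2 m (P t (of_ell2 m h))"

lemma S_to_ell2: "f \<in> l2 m \<Longrightarrow> S t (to_ell2 m f) = to_ell2 m (P t f)"
  by (simp add: S_def)

sublocale C0_semigroup S
proof (rule C0_semigroup.intro)
  fix t :: real assume t: "0 \<le> t"
  have lin: "S t (\<alpha> *\<^sub>R g + \<beta> *\<^sub>R h) = \<alpha> *\<^sub>R S t g + \<beta> *\<^sub>R S t h" for \<alpha> \<beta> g h
    by (simp add: S_def of_ell2_combine P_linear to_ell2_combine P_l2 t)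
  obtain M where M: "\<forall>f\<in>l2 m. l2_norm m (P t f) \<le> M * l2_norm m f"
    using P_bounded[OF t] by blast
  show "bounded_linear (S t)"
  proof (rule bounded_linear_intro)
    show "S t (g + h) = S t g + S t h" for g h
      using lin[of 1 g 1 h] by simp
    show "S t (r *\<^sub>R h) = r *\<^sub>R S t h" for r h
      using lin[of r h 0 h] by simp
    show "norm (S t h) \<le> norm h * M" for h
      using bspec[OF M of_ell2_in_l2[of h]]
      by (simp add: S_def norm_to_ell2[symmetric] P_l2 t mult.commute)
  qed
next
  show "S 0 h = h" for h
    by (simp add: S_def P_0)
next
  show "S (s + t) h = S s (S t h)" if "0 \<le> s" "0 \<le> t" for s t h
    using that by (simp add: S_def P_add P_l2)
next
  fix h
  have "((\<lambda>t. norm (S t h - h)) \<longlongrightarrow> 0) (at_right 0)"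
  proof (rule Lim_transform_eventually[OF P_right_continuous[OF of_ell2_in_l2[of h]]])
    show "\<forall>\<^sub>F t in at_right 0. l2_norm m (\<lambda>x. P t (of_ell2 m h) x - of_ell2 m h x) = norm (S t h - h)"
      using eventually_at_right_less[of 0]
      by eventually_elim (simp add: S_def norm_to_ell2[symmetric] l2_diff P_l2 to_ell2_diff)
  qed
  then show "((\<lambda>t. S t h) \<longlongrightarrow> h) (at_right 0)"
    by (rule LIM_zero_cancel[OF tendsto_norm_zero_cancel])
qed

lemma l2_generator_iff:
  assumes "f \<in> l2 m" "g \<in> l2 m"
  shows "(f, g) \<in> l2_generator m P \<longleftrightarrow> has_generator (to_ell2 m f) (to_ell2 m g)"
proof -
  have eq: "\<forall>\<^sub>F t in at_right 0. l2_norm m (\<lambda>x. (P t f x - f x) / t - g x) =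
      norm ((S t (to_ell2 m f) - to_ell2 m f) /\<^sub>R t - to_ell2 m g)"
    using eventually_at_right_less[of 0]
  proof eventually_elim
    case (elim t)
    have 1: "(\<lambda>x. P t f x - f x) \<in> l2 m"
      using elim assms by (intro l2_diff P_l2) auto
    have "(\<lambda>x. (P t f x - f x) / t - g x) = (\<lambda>x. inverse t * (P t f x - f x) + (-1) * g x)"
      by (simp add: divide_inverse_commute)
    moreover have "to_ell2 m \<dots> = (S t (to_ell2 m f) - to_ell2 m f) /\<^sub>R t - to_ell2 m g"
      using elim assms 1 by (subst to_ell2_combine) (auto simp: S_to_ell2 to_ell2_diff P_l2)
    ultimately show ?case
      using l2_combine[OF 1 assms(2), of "inverse t" "-1"] norm_to_ell2 by metis
  qed
  show ?thesis
    unfolding l2_generator_def has_generator_def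
    using assms by (simp add: filterlim_cong[OF refl refl eq] tendsto_norm_zero_iff LIM_zero_iff)
qed

lemma generator_iff:
  assumes "f \<in> l2 m" "g \<in> l2 m"
  shows "has_generator (to_ell2 m f) (to_ell2 m g) \<longleftrightarrow> (f, \<lambda>x. - g x) \<in> graph_operator b m"
proof -
  have "has_generator (to_ell2 m f) (to_ell2 m g) \<longleftrightarrow> (f, g) \<in> l2_generator m P"
    by (simp add: l2_generator_iff assms)
  also have "\<dots> \<longleftrightarrow> (\<exists>g'. g = (\<lambda>x. - g' x) \<and> (f, g') \<in> graph_operator b m)"
    using heat by (auto simp: heat_semigroup_def)
  also have "\<dots> \<longleftrightarrow> (f, \<lambda>x. - g x) \<in> graph_operator b m"
    by (auto intro!: exI[of _ "\<lambda>x. - g x"])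
  finally show ?thesis .
qed

lemma has_generator_Cc: "f \<in> Cc \<Longrightarrow> has_generator (to_ell2 m f) (to_ell2 m (laplacian b m f))"
  by (simp add: generator_iff Cc_in_l2 laplacian_Cc graph_operator_Cc)

lemma graph_operator_P:
  assumes f: "f \<in> Cc" and t: "0 \<le> t"
  shows "(P t f, \<lambda>x. - P t (laplacian b m f) x) \<in> graph_operator b m"
  using has_generator_orbit[OF has_generator_Cc[OF f] t] assms
  by (simp add: S_to_ell2 Cc_in_l2 laplacian_Cc generator_iff P_l2)

text \<open>Orbits of \<open>Cc\<close> stay in the domain of the operator, and there it is
  -\<Delta>. Hence \<open>P t f\<close> solves the heat equation pointwise.\<close>

lemma laplacian_P: "f \<in> Cc \<Longrightarrow> 0 \<le> t \<Longrightarrow> laplacian b m (P t f) = P t (laplacian b m f)"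
  using graph_operator_eq_laplacian[OF graph_operator_P] by (simp add: fun_eq_iff)

lemma P_has_derivative:
  assumes f: "f \<in> Cc" and t: "0 \<le> t"
  shows "((\<lambda>s. P s f x) has_real_derivative P t (laplacian b m f) x) (at t within {0..})"
proof -
  have "((\<lambda>s. coord (S s (to_ell2 m f)) x) has_vector_derivative
      coord (S t (to_ell2 m (laplacian b m f))) x) (at t within {0..})"
    by (rule bounded_linear.has_vector_derivative[OF bounded_linear_coord
          has_vector_derivative_orbit[OF has_generator_Cc[OF f] t]])
  then have "((\<lambda>s. coord (S s (to_ell2 m f)) x / sqrt (m x)) has_real_derivative
      coord (S t (to_ell2 m (laplacian b m f))) x / sqrt (m x)) (at t within {0..})"
    by (intro DERIV_cdivide) (simp add: has_real_derivative_iff_has_vector_derivative)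
  moreover have "coord (S s (to_ell2 m g)) x / sqrt (m x) = P s g x" if "0 \<le> s" "g \<in> l2 m" for s g
    using that by (simp add: S_to_ell2 coord_to_ell2 P_l2)
  ultimately have 1: "((\<lambda>s. coord (S s (to_ell2 m f)) x / sqrt (m x)) has_real_derivative
      P t (laplacian b m f) x) (at t within {0..})"
    and 2: "\<And>s. s \<in> {0..} \<Longrightarrow> coord (S s (to_ell2 m f)) x / sqrt (m x) = P s f x"
    using f t by (simp_all add: Cc_in_l2 laplacian_Cc)
  \<comment> \<open>Square summability of \<open>P s f\<close>, and with it this formula for its
    coordinates, is known for \<open>0 \<le> s\<close> only; so the derivative is taken within the
    half line.\<close>
  show ?thesis
    by (rule has_field_derivative_transform_within[OF 1 zero_less_one _ 2]) (use t in auto)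
qed

lemma P_continuous: "f \<in> l2 m \<Longrightarrow> continuous_on {0..} (\<lambda>t. to_ell2 m (P t f))"
  using continuous_on_orbit[of "to_ell2 m f"] by (simp add: S_to_ell2)

text \<open>The squared norm of \<open>(P t f - c)\<^sup>+\<close> starts at \<open>0\<close> and does not increase.\<close>

lemma P_le:
  assumes f: "f \<in> Cc" and le: "\<And>x. f x \<le> c" and c: "0 \<le> c" and t: "0 \<le> t"
  shows "P t f x \<le> c"
proof -
  define a where "a x = c * sqrt (m x)" for x
  have a: "0 \<le> a x" for x
    using c by (simp add: a_def)
  define E where "E s = (norm (excess a (S s (to_ell2 m f))))\<^sup>2" for s
  have deriv: "(E has_real_derivative
      2 * inner (excess a (S s (to_ell2 m f))) (S s (to_ell2 m (laplacian b m f)))) (at s within {0..})"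
    if "0 \<le> s" for s
  proof -
    have "((\<lambda>s. S s (to_ell2 m f)) has_derivative (\<lambda>r. r *\<^sub>R S s (to_ell2 m (laplacian b m f))))
        (at s within {0..})"
      using has_vector_derivative_orbit[OF has_generator_Cc[OF f] that]
      by (simp add: has_vector_derivative_def)
    from has_derivative_compose[OF this has_derivative_norm_excess[OF a]]
    show ?thesis
      unfolding has_field_derivative_def E_def
      by (rule has_derivative_eq_rhs) (simp add: fun_eq_iff)
  qed
  \<comment> \<open>With u = \<open>P s f\<close> this is -2 times the pairing of Lu with (u -
    c)^+.\<close>
  have nonpos: "2 * inner (excess a (S s (to_ell2 m f))) (S s (to_ell2 m (laplacian b m f))) \<le> 0"
    if "0 \<le> s" for s
    using graph_operator_excess[OF graph_operator_P[OF f that] c] f that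
    by (simp add: S_to_ell2 Cc_in_l2 laplacian_Cc a_def[abs_def] to_ell2_uminus P_l2 inner_commute)
  have "E t \<le> E 0"
  proof -
    let ?D = "\<lambda>s. 2 * inner (excess a (S s (to_ell2 m f))) (S s (to_ell2 m (laplacian b m f)))"
    have "\<exists>s\<in>{0..t}. E t - E 0 = ?D s * (t - 0)"
    proof (rule mvt_very_simple[OF t, of E "\<lambda>s r. ?D s * r"])
      show "(E has_derivative (*) (?D s)) (at s within {0..t})" if "0 \<le> s" "s \<le> t" for s
        using deriv[OF that(1)] unfolding has_field_derivative_def
        by (rule has_derivative_subset) simp
    qed
    then obtain s where s: "0 \<le> s" "E t - E 0 = ?D s * (t - 0)"
      by auto
    have "?D s * (t - 0) \<le> 0"
      by (rule mult_nonpos_nonneg[OF nonpos[OF s(1)]]) (use t in simp)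
    then show ?thesis
      using s(2) by linarith
  qed
  moreover have "excess a (to_ell2 m f) = 0"
  proof (rule ell2_eqI)
    show "coord (excess a (to_ell2 m f)) x = coord 0 x" for x
      using le[of x] by (simp add: coord_excess[OF a] coord_to_ell2 Cc_in_l2 f a_def max_def
          antisym mult_right_mono)
  qed
  ultimately have "excess a (S t (to_ell2 m f)) = 0"
    by (simp add: E_def zero)
  then have "max (coord (S t (to_ell2 m f)) x - a x) 0 = 0"
    using coord_excess[of a "S t (to_ell2 m f)" x, OF a] by simp
  then have "coord (S t (to_ell2 m f)) x \<le> a x"
    by linarith
  then have "P t f x * sqrt (m x) \<le> c * sqrt (m x)"
    using f t by (simp only: S_to_ell2 Cc_in_l2 coord_to_ell2 P_l2 a_def)
  then show ?thesis
    by (simp add: mult_le_cancel_right)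
qed

lemma P_uminus: "0 \<le> t \<Longrightarrow> f \<in> l2 m \<Longrightarrow> P t (\<lambda>x. - f x) = (\<lambda>x. - P t f x)"
  using P_linear[of t f f "-1" 0] by simp

lemma P_abs_le:
  assumes "f \<in> Cc" "\<And>x. \<bar>f x\<bar> \<le> c" "0 \<le> t"
  shows "\<bar>P t f x\<bar> \<le> c"
proof -
  have "0 \<le> c"
    using assms(2)[of x] by linarith
  then show ?thesis
    using P_le[of f c t x] P_le[of "\<lambda>x. - f x" c t x] assms
    by (auto simp: P_uminus Cc_in_l2 Cc_uminus abs_le_iff)
qed

text \<open>Square summability is part of the conclusion because the induction needs it to apply
  linearity.\<close>

lemma P_sum:
  assumes "finite F" "\<And>y. y \<in> F \<Longrightarrow> f y \<in> l2 m" "0 \<le> t"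
  shows "P t (\<lambda>x. \<Sum>y\<in>F. c y * f y x) = (\<lambda>x. \<Sum>y\<in>F. c y * P t (f y) x)
    \<and> (\<lambda>x. \<Sum>y\<in>F. c y * f y x) \<in> l2 m"
  using assms
proof (induction F rule: finite_induct)
  case empty
  have "(\<lambda>_. 0) \<in> l2 m"
    by (simp add: l2_def)
  then show ?case
    using P_linear[of t "\<lambda>_. 0" "\<lambda>_. 0" 0 0] empty by simp
next
  case (insert y F)
  then have IH: "P t (\<lambda>x. \<Sum>y\<in>F. c y * f y x) = (\<lambda>x. \<Sum>y\<in>F. c y * P t (f y) x)"
    "(\<lambda>x. \<Sum>y\<in>F. c y * f y x) \<in> l2 m" "f y \<in> l2 m"
    by auto
  show ?case
    using P_linear[OF insert.prems(2) IH(3,2), of "c y" 1] l2_combine[OF IH(3,2), of "c y" 1]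
      insert.hyps by (simp add: IH(1))
qed

text \<open>Expanding \<open>f\<close> in indicators makes the kernel sum finite. In this way the
  Feller property, stated for the kernel sum, reaches \<open>P\<close>.\<close>

lemma heat_extension_Cc:
  assumes f: "f \<in> Cc" and t: "0 \<le> t"
  shows "heat_extension m P t f = P t f"
proof
  fix x
  let ?F = "{y. f y \<noteq> 0}"
  have fin: "finite ?F"
    using f by (simp add: Cc_def)
  have "(\<Sum>y\<in>?F. f y * indicator {y} z) = (\<Sum>y\<in>?F. if y = z then f z else 0)" for z
    by (rule sum.cong) (auto simp: indicator_def)
  then have "f z = (\<Sum>y\<in>?F. f y * indicator {y} z)" for z
    using fin by simp
  then have f_eq: "f = (\<lambda>z. \<Sum>y\<in>?F. f y * indicator {y} z)"
    by blast
  have "heat_extension m P t f x = (\<Sum>\<^sub>\<infinity>y\<in>?F. heat_kernel m P t x y * f y * m y)"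
    unfolding heat_extension_def by (rule infsum_cong_neutral) auto
  also have "\<dots> = (\<Sum>y\<in>?F. f y * P t (indicator {y}) x)"
    using fin by (simp add: heat_kernel_def mult.commute)
  also have "\<dots> = P t (\<lambda>z. \<Sum>y\<in>?F. f y * indicator {y} z) x"
    by (subst P_sum[OF fin indicator_in_l2 t, THEN conjunct1]) (rule refl)
  also have "\<dots> = P t f x"
    using f_eq by simp
  finally show "heat_extension m P t f x = P t f x" .
qed

end


section \<open>Compactness and decay\<close>

text \<open>A finite net in \<open>K\<close> reduces uniform smallness of tails to finitely many
  vectors, whose exceptional sets have a finite union.\<close>

lemma ell2_compact_tail:
  fixes K :: "'a ell2 set"
  assumes K: "compact K" and e: "0 < e"
  obtains A where "finite A"
    "\<And>h B. h \<in> K \<Longrightarrow> finite B \<Longrightarrow> B \<inter> A = {} \<Longrightarrow> (\<Sum>x\<in>B. (coord h x)\<^sup>2) \<le> e"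
proof -
  have ex: "\<exists>A. finite A \<and> (\<forall>B. finite B \<longrightarrow> B \<inter> A = {} \<longrightarrow> (\<Sum>x\<in>B. (coord k x)\<^sup>2) \<le> e / 4)" for k :: "'a ell2"
    by (rule ell2_tail[of "e / 4" k]) (use e in auto)
  have "\<exists>A. \<forall>k :: 'a ell2. finite (A k) \<and> (\<forall>B. finite B \<longrightarrow> B \<inter> A k = {} \<longrightarrow>
      (\<Sum>x\<in>B. (coord k x)\<^sup>2) \<le> e / 4)"
    by (intro choice allI ex)
  then obtain A where A': "\<forall>k :: 'a ell2. finite (A k) \<and> (\<forall>B. finite B \<longrightarrow> B \<inter> A k = {} \<longrightarrow>
      (\<Sum>x\<in>B. (coord k x)\<^sup>2) \<le> e / 4)" ..
  then have A: "finite (A k)"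
    "finite B \<Longrightarrow> B \<inter> A k = {} \<Longrightarrow> (\<Sum>x\<in>B. (coord k x)\<^sup>2) \<le> e / 4" for k B
    by auto
  \<comment> \<open>The splitting below doubles both the tail of the net vector and the squared
    radius, so \<open>e / 4\<close> for each adds up to \<open>e\<close>.\<close>
  define r where "r = sqrt (e / 4)"
  have r: "0 < r" "r\<^sup>2 = e / 4"
    using e by (simp_all add: r_def)
  obtain C where C: "C \<subseteq> K" "finite C" "K \<subseteq> (\<Union>k\<in>C. ball k r)"
    by (rule compactE_image[OF K, of K "\<lambda>k. ball k r"]) (use r(1) in auto)
  show ?thesis
  proof
    show "finite (\<Union>k\<in>C. A k)"
      using C(2) A(1) by blast
    fix h B assume h: "h \<in> K" and B: "finite B" "B \<inter> (\<Union>k\<in>C. A k) = {}"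
    obtain k where k: "k \<in> C" "dist k h < r"
      using C(3) h by auto
    have "(\<Sum>x\<in>B. (coord h x)\<^sup>2) \<le> (\<Sum>x\<in>B. 2 * (coord k x)\<^sup>2 + 2 * (coord (k - h) x)\<^sup>2)"
    proof (rule sum_mono)
      fix x
      have "0 \<le> (2 * coord k x - coord h x)\<^sup>2"
        by simp
      then show "(coord h x)\<^sup>2 \<le> 2 * (coord k x)\<^sup>2 + 2 * (coord (k - h) x)\<^sup>2"
        by (simp add: power2_eq_square algebra_simps)
    qed
    also have "\<dots> = 2 * (\<Sum>x\<in>B. (coord k x)\<^sup>2) + 2 * (\<Sum>x\<in>B. (coord (k - h) x)\<^sup>2)"
      by (simp add: sum.distrib sum_distrib_left)
    also have "\<dots> \<le> 2 * (e / 4) + 2 * r\<^sup>2"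
    proof (intro add_mono mult_left_mono)
      show "(\<Sum>x\<in>B. (coord k x)\<^sup>2) \<le> e / 4"
        using B k(1) by (intro A(2)) auto
      have "(norm (k - h))\<^sup>2 \<le> r\<^sup>2"
        using k(2) by (intro power_mono) (auto simp: dist_norm)
      then show "(\<Sum>x\<in>B. (coord (k - h) x)\<^sup>2) \<le> r\<^sup>2"
        using sum_coord_square_le[OF B(1), of "k - h"] by linarith
    qed simp_all
    finally show "(\<Sum>x\<in>B. (coord h x)\<^sup>2) \<le> e"
      using r(2) by simp
  qed
qed

lemma Cc_subset_C0: "f \<in> Cc \<Longrightarrow> f \<in> C0"
  unfolding C0_def by (auto intro!: bexI[of _ f])

lemma C0_finite:
  assumes "f \<in> C0" "0 < e"
  shows "finite {x. e < \<bar>f x\<bar>}"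
proof -
  obtain \<phi> where \<phi>: "\<phi> \<in> Cc" "\<And>x. \<bar>f x - \<phi> x\<bar> \<le> e"
    using assms unfolding C0_def by blast
  have "{x. e < \<bar>f x\<bar>} \<subseteq> {x. \<phi> x \<noteq> 0}"
  proof
    fix x assume "x \<in> {x. e < \<bar>f x\<bar>}"
    then show "x \<in> {x. \<phi> x \<noteq> 0}"
      using \<phi>(2)[of x] by auto
  qed
  then show ?thesis
    using \<phi>(1) by (auto simp: Cc_def intro: finite_subset)
qed


section \<open>The carre du champ\<close>

context weighted_graph
begin

lemma laplacian_combine:
  "laplacian b m (\<lambda>x. c * f x + g x) x = c * laplacian b m f x + laplacian b m g x"
proof -
  have "(\<Sum>y | 0 < b x y. b x y * (c * f y + g y - (c * f x + g x))) =
      c * (\<Sum>y | 0 < b x y. b x y * (f y - f x)) + (\<Sum>y | 0 < b x y. b x y * (g y - g x))"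
    unfolding sum_distrib_left sum.distrib[symmetric]
    by (intro sum.cong refl) (simp add: algebra_simps)
  then show ?thesis
    by (simp add: laplacian_def distrib_left)
qed

lemma Gam_1: "Gam b m 1 f g x = (\<Sum>y | 0 < b x y. b x y * ((f y - f x) * (g y - g x))) / (2 * m x)"
proof -
  have "Gam b m 1 f g x = (1 / m x * (\<Sum>y | 0 < b x y. b x y * (f y * g y - f x * g x))
      - f x * (1 / m x * (\<Sum>y | 0 < b x y. b x y * (g y - g x)))
      - (1 / m x * (\<Sum>y | 0 < b x y. b x y * (f y - f x))) * g x) / 2"
    by (simp add: laplacian_def)
  also have "\<dots> = ((\<Sum>y | 0 < b x y. b x y * (f y * g y - f x * g x))
      - f x * (\<Sum>y | 0 < b x y. b x y * (g y - g x))
      - (\<Sum>y | 0 < b x y. b x y * (f y - f x)) * g x) / (2 * m x)"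
    by (simp add: field_simps)
  also have "(\<Sum>y | 0 < b x y. b x y * (f y * g y - f x * g x))
      - f x * (\<Sum>y | 0 < b x y. b x y * (g y - g x))
      - (\<Sum>y | 0 < b x y. b x y * (f y - f x)) * g x =
      (\<Sum>y | 0 < b x y. b x y * ((f y - f x) * (g y - g x)))"
    unfolding sum_distrib_left sum_distrib_right sum_subtractf[symmetric]
    by (intro sum.cong refl) (simp add: algebra_simps)
  finally show ?thesis .
qed

lemma laplacian_square:
  "laplacian b m (\<lambda>x. (f x)\<^sup>2) x = 2 * Gam b m 1 f f x + 2 * f x * laplacian b m f x"
  by (simp add: power2_eq_square field_simps)

lemma Gam_nonneg: "0 \<le> Gam b m 1 f f x"
  unfolding Gam_1
  by (intro divide_nonneg_pos sum_nonneg mult_nonneg_nonneg[OF b_nonneg zero_le_square]) simp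

lemma Gam_compose_lipschitz:
  assumes "\<And>u v. \<bar>T u - T v\<bar> \<le> L * \<bar>u - v\<bar>"
  shows "Gam b m 1 (\<lambda>x. T (f x)) (\<lambda>x. T (f x)) x \<le> L\<^sup>2 * Gam b m 1 f f x"
proof -
  have "(T u - T v) * (T u - T v) \<le> L\<^sup>2 * ((u - v) * (u - v))" for u v
    using power_mono[OF assms[of u v], of 2] by (simp add: power2_eq_square mult_ac abs_mult_self_eq)
  then have "(\<Sum>y | 0 < b x y. b x y * ((T (f y) - T (f x)) * (T (f y) - T (f x)))) \<le>
      (\<Sum>y | 0 < b x y. b x y * (L\<^sup>2 * ((f y - f x) * (f y - f x))))"
    by (intro sum_mono mult_left_mono) auto
  also have "\<dots> = L\<^sup>2 * (\<Sum>y | 0 < b x y. b x y * ((f y - f x) * (f y - f x)))"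
    by (simp add: sum_distrib_left mult_ac)
  finally show ?thesis
    unfolding Gam_1 times_divide_eq_right by (intro divide_right_mono) auto
qed

text \<open>By symmetry of \<Gamma> the two mixed terms of \<Gamma>_2 coincide; this is the Bochner
  inequality that makes the subsolution work.\<close>

lemma CD_0_Gam:
  assumes "CD_inf b m 0"
  shows "2 * Gam b m 1 f (laplacian b m f) x \<le> laplacian b m (Gam b m 1 f f) x"
proof -
  have half: "0 \<le> (u - v - w) / 2 \<Longrightarrow> w = v \<Longrightarrow> 2 * v \<le> u" for u v w :: real
    by simp
  have "0 \<le> Gam b m (Suc 1) f f x"
    using assms unfolding CD_inf_def by (metis Suc_1 mult_zero_left)
  moreover have "Gam b m 1 (laplacian b m f) f x = Gam b m 1 f (laplacian b m f) x"
    unfolding Gam_1 by (simp add: mult.commute)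
  ultimately show ?thesis
    unfolding Gam.simps(2)[of b m 1] by (rule half)
qed

text \<open>Since 2 \<Gamma>(f) = \<Delta>(f^2) - 2 f \<Delta>f, one may drop -f(x)^2 from each
  summand of \<Delta>(f^2); ellipticity then cancels the factor 1 / m(x) and leaves an l2
  sum.\<close>

lemma Gam_le:
  assumes C: "\<And>x y. b x y \<le> C * m x * m y"
  shows "Gam b m 1 f f x \<le> C / 2 * (\<Sum>y | 0 < b x y. (f y)\<^sup>2 * m y) + \<bar>f x * laplacian b m f x\<bar>"
proof -
  have "laplacian b m (\<lambda>x. (f x)\<^sup>2) x \<le> 1 / m x * (\<Sum>y | 0 < b x y. (C * m x * m y) * (f y)\<^sup>2)"
    unfolding laplacian_def
  proof (intro mult_left_mono sum_mono)
    fix y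
    have "b x y * ((f y)\<^sup>2 - (f x)\<^sup>2) \<le> b x y * (f y)\<^sup>2"
      by (intro mult_left_mono) auto
    also have "\<dots> \<le> (C * m x * m y) * (f y)\<^sup>2"
      by (intro mult_right_mono C) simp
    finally show "b x y * ((f y)\<^sup>2 - (f x)\<^sup>2) \<le> (C * m x * m y) * (f y)\<^sup>2" .
  qed simp
  also have "\<dots> = C * (\<Sum>y | 0 < b x y. (f y)\<^sup>2 * m y)"
    by (simp add: sum_distrib_left mult_ac)
  finally show ?thesis
    using laplacian_square[of f x] by linarith
qed

lemma Gam_has_derivative:
  assumes "\<And>y. ((\<lambda>s. u s y) has_real_derivative v y) (at t within I)"
  shows "((\<lambda>s. Gam b m 1 (u s) (u s) x) has_real_derivative 2 * Gam b m 1 (u t) v x) (at t within I)"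
proof -
  have "((\<lambda>s. (\<Sum>y | 0 < b x y. b x y * ((u s y - u s x) * (u s y - u s x))) / (2 * m x))
      has_real_derivative (\<Sum>y | 0 < b x y. b x y * ((u t y - u t x) * (v y - v x)
        + (v y - v x) * (u t y - u t x))) / (2 * m x)) (at t within I)"
    by (intro DERIV_cdivide DERIV_sum DERIV_cmult DERIV_mult' DERIV_diff assms)
  moreover have "(\<Sum>y | 0 < b x y. b x y * ((u t y - u t x) * (v y - v x)
        + (v y - v x) * (u t y - u t x))) / (2 * m x) = 2 * Gam b m 1 (u t) v x"
    unfolding Gam_1 times_divide_eq_right sum_distrib_left
    by (intro arg_cong2[where f=divide] sum.cong refl) (simp add: algebra_simps)
  ultimately show ?thesis
    unfolding Gam_1 by simp
qed

text \<open>If the bound fails, a small tilt in time yields a spacetime maximum at a positive time.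
  There \<Delta>F \<le> 0 forces a strictly negative time derivative of the tilted function,
  although earlier values are not larger.\<close>

lemma parabolic_maximum_principle:
  assumes deriv: "\<And>t x. 0 \<le> t \<Longrightarrow> t \<le> T \<Longrightarrow>
      ((\<lambda>s. F s x) has_real_derivative F' t x) (at t within {0..T})"
    and sub: "\<And>t x. 0 \<le> t \<Longrightarrow> t \<le> T \<Longrightarrow> F' t x \<le> laplacian b m (F t) x"
    and init: "\<And>x. F 0 x \<le> M"
    and vanish: "\<And>e. 0 < e \<Longrightarrow> \<exists>A. finite A \<and> (\<forall>t x. 0 \<le> t \<longrightarrow> t \<le> T \<longrightarrow> x \<notin> A \<longrightarrow> F t x \<le> M + e)"
    and t: "0 \<le> t" "t \<le> T"
  shows "F t x \<le> M"
proof (rule ccontr)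
  assume "\<not> F t x \<le> M"
  define e where "e = (F t x - M) / 2"
  have e: "0 < e"
    using \<open>\<not> F t x \<le> M\<close> by (simp add: e_def)
  have Fe: "F t x = M + 2 * e"
    unfolding e_def by (simp add: field_simps)
  \<comment> \<open>The tilt costs at most \<open>e / 2\<close>, so at \<open>(t, x)\<close> the
    tilted function still exceeds \<open>e\<close>, its bound outside \<open>A\<close>. The summand
    1 covers \<open>T = 0\<close>.\<close>
  define \<eta> where "\<eta> = e / 2 / (T + 1)"
  have T: "0 \<le> T"
    using t by linarith
  have \<eta>: "0 < \<eta>"
    using e T by (simp add: \<eta>_def)
  have "\<eta> * t \<le> \<eta> * (T + 1)"
    using t \<eta> by (intro mult_left_mono) auto
  also have "\<dots> = e / 2"
    using T unfolding \<eta>_def by (intro nonzero_eq_divide_eq[THEN iffD1, OF _ refl]) simp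
  finally have \<eta>t: "\<eta> * t \<le> e / 2" .
  define G where "G s y = F s y - M - \<eta> * s" for s y
  obtain A where A: "finite A" "\<And>s y. 0 \<le> s \<Longrightarrow> s \<le> T \<Longrightarrow> y \<notin> A \<Longrightarrow> F s y \<le> M + e"
    using vanish[OF e] by blast
  \<comment> \<open>Maximizing over time at each vertex reduces the spacetime maximum to a finite
    one over \<open>insert x A\<close>.\<close>
  have "\<exists>\<tau>\<in>{0..T}. \<forall>s\<in>{0..T}. G s y \<le> G \<tau> y" for y
  proof (rule continuous_attains_sup)
    have "continuous_on {0..T} (\<lambda>s. F s y)"
      by (rule DERIV_continuous_on[where D="\<lambda>s. F' s y"]) (auto intro: deriv)
    then show "continuous_on {0..T} (\<lambda>s. G s y)"
      unfolding G_def by (intro continuous_intros)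
  qed (use T in auto)
  then have "\<forall>y. \<exists>\<tau>. 0 \<le> \<tau> \<and> \<tau> \<le> T \<and> (\<forall>s. 0 \<le> s \<longrightarrow> s \<le> T \<longrightarrow> G s y \<le> G \<tau> y)"
    by force
  from choice[OF this] obtain \<tau> where \<tau>: "\<And>y. 0 \<le> \<tau> y" "\<And>y. \<tau> y \<le> T"
    "\<And>y s. 0 \<le> s \<Longrightarrow> s \<le> T \<Longrightarrow> G s y \<le> G (\<tau> y) y"
    by blast
  let ?H = "\<lambda>y. G (\<tau> y) y"
  have fin: "finite (?H ` insert x A)"
    using A(1) by simp
  have "Max (?H ` insert x A) \<in> ?H ` insert x A"
    by (rule Max_in[OF fin]) simp
  then obtain x0 where "x0 \<in> insert x A" and max0: "Max (?H ` insert x A) = ?H x0"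
    by (elim imageE) (rule that)
  have x0: "G (\<tau> y) y \<le> G (\<tau> x0) x0" if "y \<in> insert x A" for y
    using Max_ge[OF fin imageI[OF that]] by (simp only: max0)
  define t0 where "t0 = \<tau> x0"
  have t0: "0 \<le> t0" "t0 \<le> T"
    using \<tau> by (auto simp: t0_def)
  have base: "e < G t0 x0"
  proof -
    have "G t x \<le> G t0 x0"
      using x0[of x] \<tau>(3)[OF t, of x] by (simp add: t0_def)
    then show ?thesis
      using e Fe \<eta>t by (simp add: G_def)
  qed
  have max: "G s y \<le> G t0 x0" if s: "0 \<le> s" "s \<le> T" for s y
  proof (cases "y \<in> insert x A")
    case True
    then show ?thesis
      using x0[of y] \<tau>(3)[OF s, of y] by (simp add: t0_def)
  next
    case False
    then have "G s y \<le> e - \<eta> * s"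
      using A(2)[OF s, of y] by (simp add: G_def)
    also have "\<dots> \<le> e"
      using \<eta> s by simp
    finally show ?thesis
      using base by linarith
  qed
  have "t0 \<noteq> 0"
    using init[of x0] base e by (auto simp: G_def)
  have "F t0 y \<le> F t0 x0" for y
    using max[OF t0, of y] by (simp add: G_def)
  then have "laplacian b m (F t0) x0 \<le> 0"
    unfolding laplacian_def by (intro mult_nonneg_nonpos sum_nonpos) auto
  then have neg: "F' t0 x0 - \<eta> < 0"
    using sub[OF t0, of x0] \<eta> by linarith
  \<comment> \<open>Only earlier times are compared, so a derivative within [0,T] also serves when
    \<open>t0 = T\<close>.\<close>
  have "((\<lambda>s. G s x0) has_real_derivative F' t0 x0 - \<eta>) (at t0 within {0..T})"
    unfolding G_def using deriv[OF t0, of x0] by (auto intro!: derivative_eq_intros)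
  from has_real_derivative_neg_dec_left[OF this neg]
  obtain d where d: "0 < d" "\<And>h. 0 < h \<Longrightarrow> t0 - h \<in> {0..T} \<Longrightarrow> h < d \<Longrightarrow> G t0 x0 < G (t0 - h) x0"
    by blast
  define h where "h = min (d / 2) t0"
  have "0 < h" "h < d" "0 \<le> t0 - h" "t0 - h \<le> T"
    using d(1) t0 \<open>t0 \<noteq> 0\<close> by (auto simp: h_def)
  then have "G t0 x0 < G (t0 - h) x0"
    by (intro d(2)) auto
  then show False
    using max[OF \<open>0 \<le> t0 - h\<close> \<open>t0 - h \<le> T\<close>, of x0] by linarith
qed

end


section \<open>The gradient estimate\<close>

context heat_flow
begin

text \<open>The time derivative is \<open>P t\<close> applied to \<Delta>f, so the contraction
  property gives a Lipschitz constant common to all vertices.\<close>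

lemma P_lipschitz:
  assumes f: "f \<in> Cc" and K: "\<And>y. \<bar>laplacian b m f y\<bar> \<le> K" and st: "0 \<le> s" "0 \<le> t"
  shows "\<bar>P s f x - P t f x\<bar> \<le> K * \<bar>s - t\<bar>"
proof -
  have "norm (P s f x - P t f x) \<le> K * norm (s - t)"
  proof (rule field_differentiable_bound[of "{0..}" "\<lambda>s. P s f x" "\<lambda>s. P s (laplacian b m f) x"])
    show "((\<lambda>s. P s f x) has_real_derivative P r (laplacian b m f) x) (at r within {0..})"
      if "r \<in> {0..}" for r
      using that by (intro P_has_derivative f) simp
    show "norm (P r (laplacian b m f) x) \<le> K" if "r \<in> {0..}" for r
      using P_abs_le[OF laplacian_Cc[OF f] K, of r x] that by simp
  qed (use st in auto)
  then show ?thesis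
    by simp
qed

lemma P_C0:
  assumes "feller m P" "f \<in> Cc" "0 \<le> t"
  shows "P t f \<in> C0"
  using assms heat_extension_Cc[OF assms(2,3)] Cc_subset_C0[OF assms(2)]
  unfolding feller_def by (metis image_subset_iff)

text \<open>The Feller property is invoked at the finitely many times of a net; the Lipschitz
  estimate reaches the rest of [0,T].\<close>

lemma P_vanishes_uniformly:
  assumes P: "feller m P" and f: "f \<in> Cc" and e: "0 < e"
  obtains A where "finite A" "\<And>t x. 0 \<le> t \<Longrightarrow> t \<le> T \<Longrightarrow> x \<notin> A \<Longrightarrow> \<bar>P t f x\<bar> \<le> e"
proof -
  obtain K where K: "0 \<le> K" "\<And>x. \<bar>laplacian b m f x\<bar> \<le> K"
    using Cc_bounded[OF laplacian_Cc[OF f]] by blast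
  \<comment> \<open>Mesh with \<open>(K + 1) * d = e / 2\<close>; the summand 1 avoids division by
    0.\<close>
  define d where "d = e / 2 / (K + 1)"
  have d: "0 < d"
    using e K(1) by (simp add: d_def)
  obtain C where C: "C \<subseteq> {0..T}" "finite C" "{0..T} \<subseteq> (\<Union>s\<in>C. ball s d)"
    by (rule compactE_image[of "{0..T}" "{0..T}" "\<lambda>s. ball s d"]) (use d in auto)
  show ?thesis
  proof
    have "finite {x. e / 2 < \<bar>P s f x\<bar>}" if "s \<in> C" for s
      using that C(1) e by (intro C0_finite P_C0 P f) auto
    then show "finite (\<Union>s\<in>C. {x. e / 2 < \<bar>P s f x\<bar>})"
      using C(2) by blast
    fix t x assume t: "0 \<le> t" "t \<le> T" and x: "x \<notin> (\<Union>s\<in>C. {x. e / 2 < \<bar>P s f x\<bar>})"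
    obtain s where s: "s \<in> C" "dist s t < d"
      using C(3) t by auto
    have "\<bar>P t f x - P s f x\<bar> \<le> K * \<bar>t - s\<bar>"
      using s(1) C(1) t(1) by (intro P_lipschitz f K) auto
    also have "\<dots> \<le> (K + 1) * d"
      using s(2) K(1) by (intro mult_mono) (auto simp: dist_real_def)
    also have "\<dots> = e / 2"
    proof -
      have "K + 1 \<noteq> 0"
        using K(1) by linarith
      then show ?thesis
        unfolding d_def by (metis nonzero_mult_div_cancel_left times_divide_eq_right)
    qed
    finally have "\<bar>P t f x - P s f x\<bar> \<le> e / 2" .
    moreover have "\<bar>P s f x\<bar> \<le> e / 2"
      using x s(1) by auto
    ultimately show "\<bar>P t f x\<bar> \<le> e"
      by linarith
  qed
qed

text \<open>The orbit over [0,T] is compact as the continuous image of an interval, which makes its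
  tails uniform in time.\<close>

lemma P_l2_tail:
  assumes f: "f \<in> Cc" and e: "0 < e"
  obtains A where "finite A" "\<And>t B. 0 \<le> t \<Longrightarrow> t \<le> T \<Longrightarrow> finite B \<Longrightarrow> B \<inter> A = {} \<Longrightarrow>
    (\<Sum>y\<in>B. (P t f y)\<^sup>2 * m y) \<le> e"
proof -
  have "compact ((\<lambda>t. to_ell2 m (P t f)) ` {0..T})"
    using P_continuous[OF Cc_in_l2[OF f]]
    by (intro compact_continuous_image) (auto intro: continuous_on_subset)
  then obtain A where A: "finite A" "\<And>h B. h \<in> (\<lambda>t. to_ell2 m (P t f)) ` {0..T} \<Longrightarrow>
      finite B \<Longrightarrow> B \<inter> A = {} \<Longrightarrow> (\<Sum>x\<in>B. (coord h x)\<^sup>2) \<le> e"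
    using ell2_compact_tail e by blast
  show ?thesis
  proof (rule that[OF A(1)])
    fix t B assume t: "0 \<le> t" "t \<le> T" and B: "finite B" "B \<inter> A = {}"
    have "(\<Sum>x\<in>B. (coord (to_ell2 m (P t f)) x)\<^sup>2) \<le> e"
      using t by (intro A(2) B) auto
    then show "(\<Sum>y\<in>B. (P t f y)\<^sup>2 * m y) \<le> e"
      using t by (simp add: coord_to_ell2 P_l2 Cc_in_l2 f power_mult_distrib)
  qed
qed

text \<open>At time 0 the weight removes \<Gamma> and leaves f^2, bounded by
  \<open>K\<^sup>2\<close>; at time \<open>T\<close> the nonnegative term u^2 is discarded.\<close>

lemma gradient_estimate:
  assumes "elliptic b m" and CD: "CD_inf b m 0" and P: "feller m P"
    and f: "f \<in> Cc" and K: "\<And>x. \<bar>f x\<bar> \<le> K" and T: "0 \<le> T"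
  shows "2 * T * Gam b m 1 (P T f) (P T f) x \<le> K\<^sup>2"
proof -
  obtain C where C: "0 < C" "\<And>x y. b x y \<le> C * m x * m y"
    using assms(1) unfolding elliptic_def by blast
  obtain K1 where K1: "0 \<le> K1" "\<And>x. \<bar>laplacian b m f x\<bar> \<le> K1"
    using Cc_bounded[OF laplacian_Cc[OF f]] by blast
  have K0: "0 \<le> K"
    using K[of x] by linarith
  define F where "F t x = 2 * t * Gam b m 1 (P t f) (P t f) x + (P t f x)\<^sup>2" for t x
  define F' where "F' t x = 2 * Gam b m 1 (P t f) (P t f) x
      + 2 * t * (2 * Gam b m 1 (P t f) (laplacian b m (P t f)) x)
      + 2 * P t f x * laplacian b m (P t f) x" for t x
  have "F T x \<le> K\<^sup>2"
  proof (rule parabolic_maximum_principle[where T=T and F=F and F'=F'])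
    fix t x assume t: "0 \<le> t" "t \<le> T"
    have d: "((\<lambda>s. P s f y) has_real_derivative laplacian b m (P t f) y) (at t within {0..T})" for y
      using DERIV_subset[OF P_has_derivative[OF f t(1), of y], of "{0..T}"]
      by (simp add: laplacian_P f t)
    show "((\<lambda>s. F s x) has_real_derivative F' t x) (at t within {0..T})"
      unfolding F_def F'_def
      by (rule derivative_eq_intros d Gam_has_derivative[OF d] refl)+ (simp add: algebra_simps)
    have "laplacian b m (F t) x = 2 * t * laplacian b m (Gam b m 1 (P t f) (P t f)) x
        + laplacian b m (\<lambda>x. (P t f x)\<^sup>2) x"
      using laplacian_combine[of "2 * t" "Gam b m 1 (P t f) (P t f)" "\<lambda>x. (P t f x)\<^sup>2" x]
      unfolding F_def[abs_def] by simp
    moreover have "2 * t * (2 * Gam b m 1 (P t f) (laplacian b m (P t f)) x) \<le>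
        2 * t * laplacian b m (Gam b m 1 (P t f) (P t f)) x"
      using t by (intro mult_left_mono CD_0_Gam CD) auto
    ultimately show "F' t x \<le> laplacian b m (F t) x"
      unfolding F'_def laplacian_square by linarith
  next
    fix x
    show "F 0 x \<le> K\<^sup>2"
      using power_mono[OF K[of x], of 2] by (simp add: F_def P_0 Cc_in_l2 f)
  next
    fix e :: real assume e: "0 < e"
    \<comment> \<open>\<open>d1\<close> will bound u at infinity and \<open>d2\<close> its l2 tail.
      The final estimate is linear in both, and the denominators are their coefficients plus 1, so
      each contributes \<open>e / 2\<close>.\<close>
    define d1 where "d1 = e / 2 / (2 * T * K1 + K + 1)"
    define d2 where "d2 = e / 2 / (T * C + 1)"
    have d: "0 < d1" "0 < d2"
      using e T K0 K1(1) C(1) by (auto simp: d1_def d2_def intro!: divide_pos_pos add_nonneg_pos)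
    obtain A1 where A1: "finite A1" "\<And>t x. 0 \<le> t \<Longrightarrow> t \<le> T \<Longrightarrow> x \<notin> A1 \<Longrightarrow> \<bar>P t f x\<bar> \<le> d1"
      using P_vanishes_uniformly[OF P f d(1)] by blast
    obtain A2 where A2: "finite A2" "\<And>t B. 0 \<le> t \<Longrightarrow> t \<le> T \<Longrightarrow> finite B \<Longrightarrow> B \<inter> A2 = {} \<Longrightarrow>
        (\<Sum>y\<in>B. (P t f y)\<^sup>2 * m y) \<le> d2"
      using P_l2_tail[OF f d(2)] by blast
    \<comment> \<open>\<open>ball1 A2\<close> rather than \<open>A2\<close>, because \<Gamma> at
      \<open>x\<close> is estimated by a sum over the neighbours, all of which must avoid
      \<open>A2\<close>.\<close>
    have "F t x \<le> K\<^sup>2 + e" if t: "0 \<le> t" "t \<le> T" and x: "x \<notin> A1 \<union> ball1 A2" for t x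
    proof -
      have u: "\<bar>P t f x\<bar> \<le> d1"
        using A1(2) t x by blast
      have v: "\<bar>laplacian b m (P t f) x\<bar> \<le> K1"
        using P_abs_le[OF laplacian_Cc[OF f] K1(2) t(1)] by (simp add: laplacian_P f t)
      have "{y. 0 < b x y} \<inter> A2 = {}"
        using neighbour_notin[of x A2] x by blast
      then have tail: "(\<Sum>y | 0 < b x y. (P t f y)\<^sup>2 * m y) \<le> d2"
        by (intro A2(2) t finite_neighbours)
      have "\<bar>P t f x * laplacian b m (P t f) x\<bar> \<le> d1 * K1"
        unfolding abs_mult using u v d(1) by (intro mult_mono) auto
      moreover have "C / 2 * (\<Sum>y | 0 < b x y. (P t f y)\<^sup>2 * m y) \<le> C / 2 * d2"
        using tail C(1) by (intro mult_left_mono) auto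
      ultimately have G: "Gam b m 1 (P t f) (P t f) x \<le> C / 2 * d2 + d1 * K1"
        using Gam_le[OF C(2), of "P t f" x] by linarith
      have "2 * t * Gam b m 1 (P t f) (P t f) x \<le> 2 * T * (C / 2 * d2 + d1 * K1)"
        using t G Gam_nonneg by (intro mult_mono) auto
      \<comment> \<open>Bounding one factor by \<open>d1\<close> and the other by \<open>K\<close>
        keeps the estimate linear in \<open>d1\<close>.\<close>
      moreover have "\<bar>P t f x\<bar> * \<bar>P t f x\<bar> \<le> d1 * K"
        using u P_abs_le[OF f K t(1), of x] d(1) by (intro mult_mono) auto
      ultimately have "F t x \<le> T * C * d2 + (2 * T * K1 + K) * d1"
        unfolding F_def by (simp add: power2_eq_square algebra_simps del: Gam.simps)
      also have "\<dots> \<le> (T * C + 1) * d2 + (2 * T * K1 + K + 1) * d1"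
        using d by (simp add: algebra_simps)
      also have "\<dots> = e"
      proof -
        have "0 < T * C + 1" "0 < 2 * T * K1 + K + 1"
          using T C(1) K1(1) K0 by (auto intro!: add_nonneg_pos)
        then have "(T * C + 1) * d2 = e / 2" "(2 * T * K1 + K + 1) * d1 = e / 2"
          unfolding d1_def d2_def
          by (metis less_irrefl nonzero_mult_div_cancel_left times_divide_eq_right)+
        then show ?thesis
          by simp
      qed
      finally show ?thesis
        by (simp add: add_increasing)
    qed
    then show "\<exists>A. finite A \<and> (\<forall>t x. 0 \<le> t \<longrightarrow> t \<le> T \<longrightarrow> x \<notin> A \<longrightarrow> F t x \<le> K\<^sup>2 + e)"
      using A1(1) finite_ball1[OF A2(1)] by (intro exI[of _ "A1 \<union> ball1 A2"]) blast
  qed (use T in auto)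
  then show ?thesis
    unfolding F_def using zero_le_power2[of "P T f x"] by linarith
qed

section \<open>Cutoff functions and their nesting\<close>

lemma P_indicator_tendsto:
  assumes "stochastically_complete m P" "0 \<le> t"
  shows "((\<lambda>F. P t (indicator F) x) \<longlongrightarrow> 1) (finite_subsets_at_top UNIV)"
proof -
  let ?p = "\<lambda>y. P t (indicator {y}) x"
  have one: "(\<Sum>\<^sub>\<infinity>y. ?p y) = 1"
    using assms by (simp add: stochastically_complete_def heat_extension_def heat_kernel_def fun_eq_iff)
  \<comment> \<open>An infinite sum that does not exist has the default value 0, so the value 1
    proves summability.\<close>
  then have "?p summable_on UNIV"
    using infsum_not_exists by fastforce
  then have "((\<lambda>F. \<Sum>y\<in>F. ?p y) \<longlongrightarrow> 1) (finite_subsets_at_top UNIV)"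
    using infsum_tendsto one by fastforce
  moreover have "\<forall>\<^sub>F F in finite_subsets_at_top UNIV. (\<Sum>y\<in>F. ?p y) = P t (indicator F) x"
  proof (rule eventually_finite_subsets_at_top_weakI)
    fix F :: "'a set" assume F: "finite F"
    have "indicator F = (\<lambda>z. \<Sum>y\<in>F. 1 * indicator {y} z :: real)"
      using F by (auto simp: fun_eq_iff indicator_def)
    then show "(\<Sum>y\<in>F. ?p y) = P t (indicator F) x"
      using P_sum[of F "\<lambda>y. indicator {y}" t "\<lambda>_. 1", OF F indicator_in_l2 assms(2)] by simp
  qed
  ultimately show ?thesis
    by (rule Lim_transform_eventually)
qed

text \<open>The time is fixed by \<open>e\<close> first, and \<open>F\<close> is chosen for that
  time and \<open>K\<close> afterwards. This order is possible since the gradient bound depends on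
  the supremum of the indicator and not on \<open>F\<close>.\<close>

lemma cutoff:
  assumes EC: "elliptic b m" and CD: "CD_inf b m 0"
    and SC: "stochastically_complete m P" and feller: "feller m P"
    and K: "finite K" and e: "0 < e"
  obtains \<eta> where "\<eta> \<in> Cc" "\<And>x. 0 \<le> \<eta> x" "\<And>x. \<eta> x \<le> 1" "\<And>x. x \<in> K \<Longrightarrow> \<eta> x = 1"
    "\<And>x. Gam b m 1 \<eta> \<eta> x \<le> e"
proof -
  \<comment> \<open>The gradient estimate gives \<Gamma>(h) \<le> 1 / (2 t) = e / 4, and the slope 2
    of the truncation costs a factor 4.\<close>
  define t where "t = 2 / e"
  have t: "0 < t"
    using e by (simp add: t_def)
  \<comment> \<open>Convergence is pointwise in \<open>x\<close>; as \<open>K\<close> is finite, one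
    \<open>F\<close> serves all its points.\<close>
  have "\<forall>\<^sub>F F in finite_subsets_at_top UNIV. \<forall>x\<in>K. 3 / 4 < P t (indicator F) x"
    using t by (intro eventually_ball_finite K ballI order_tendstoD[OF P_indicator_tendsto[OF SC]]) auto
  then obtain F where F: "finite F" "\<And>x. x \<in> K \<Longrightarrow> 3 / 4 < P t (indicator F) x"
    by (auto simp: eventually_finite_subsets_at_top)
  define h where "h = P t (indicator F)"
  have FC: "indicator F \<in> Cc"
    using F(1) by (simp add: Cc_def indicator_def)
  \<comment> \<open>It vanishes up to 1/4, equals 1 from 3/4 on and has slope 2 in between.\<close>
  define cut :: "real \<Rightarrow> real" where "cut s = min 1 (max 0 (2 * s - 1 / 2))" for s
  have lip: "\<bar>cut u - cut v\<bar> \<le> 2 * \<bar>u - v\<bar>" for u v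
    by (auto simp: cut_def min_def max_def abs_if)
  show ?thesis
  proof
    \<comment> \<open>The level 1/8 lies below the threshold 1/4 of the truncation, and superlevel
      sets of a function in \<open>C0\<close> are finite.\<close>
    have "{x. cut (h x) \<noteq> 0} \<subseteq> {x. 1 / 8 < \<bar>h x\<bar>}"
      by (auto simp: cut_def min_def max_def)
    moreover have "finite {x. 1 / 8 < \<bar>h x\<bar>}"
      unfolding h_def using t by (intro C0_finite P_C0 feller FC) auto
    ultimately show "(\<lambda>x. cut (h x)) \<in> Cc"
      by (auto simp: Cc_def intro: finite_subset)
    show "cut (h x) = 1" if "x \<in> K" for x
      using F(2)[OF that] by (simp add: cut_def h_def)
    show "Gam b m 1 (\<lambda>x. cut (h x)) (\<lambda>x. cut (h x)) x \<le> e" for x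
    proof -
      have "2 * t * Gam b m 1 h h x \<le> 1\<^sup>2"
        unfolding h_def using t
        by (intro gradient_estimate EC CD feller FC) (auto simp: indicator_def)
      then have "2\<^sup>2 * Gam b m 1 h h x \<le> e"
        using e by (simp add: t_def field_simps)
      then show ?thesis
        using Gam_compose_lipschitz[of cut 2 h x, OF lip] by linarith
    qed
  qed (auto simp: cut_def)
qed

end

theorem theorem6p1:
  fixes b :: "'a::countable \<Rightarrow> 'a \<Rightarrow> real"
    and m :: "'a \<Rightarrow> real"
    and P :: "real \<Rightarrow> ('a \<Rightarrow> real) \<Rightarrow> 'a \<Rightarrow> real"
  assumes "discrete_measure m"
    and "locally_finite_graph b"
    and "elliptic b m"
    and "CD_inf b m 0"
    and "heat_semigroup b m P"
    and "stochastically_complete m P"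
    and "feller m P"
  shows "complete_graph b m"
proof -
  interpret heat_flow b m P
    by unfold_locales (rule assms)+
  \<comment> \<open>\<open>to_nat\<close> enumerates the vertices, so the third clause makes each
    vertex eventually take the value 1.\<close>
  let ?good = "\<lambda>n \<eta>. \<eta> \<in> Cc \<and> (\<forall>x. 0 \<le> \<eta> x \<and> \<eta> x \<le> 1) \<and> (\<forall>x. to_nat x < n \<longrightarrow> \<eta> x = 1) \<and>
    (\<forall>x. Gam b m 1 \<eta> \<eta> x \<le> inverse (real (Suc n)))"
  have ex: "\<exists>\<eta>. ?good n \<eta> \<and> (\<forall>x\<in>K. \<eta> x = 1)" if "finite K" for n K
  proof -
    have "finite {x :: 'a. to_nat x < n}"
      using finite_vimageI[OF finite_lessThan[of n] inj_to_nat] by (simp add: vimage_def)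
    then have "finite (K \<union> {x. to_nat x < n})"
      using that by blast
    then show ?thesis
      by (rule cutoff[OF assms(3,4,6,7), where e="inverse (real (Suc n))"]) (simp, blast)
  qed
  \<comment> \<open>Requiring the value 1 on the support of the predecessor makes the sequence
    increasing, as all values lie in [0,1].\<close>
  have "\<exists>\<eta>. \<forall>n. ?good n (\<eta> n) \<and> (\<forall>x. \<eta> n x \<noteq> 0 \<longrightarrow> \<eta> (Suc n) x = 1)"
  proof (rule dependent_nat_choice)
    show "\<exists>\<eta>. ?good 0 \<eta>"
      using ex[of "{}" 0] by blast
    show "\<exists>\<eta>'. ?good (Suc n) \<eta>' \<and> (\<forall>x. \<eta> x \<noteq> 0 \<longrightarrow> \<eta>' x = 1)" if "?good n \<eta>" for \<eta> n
    proof -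
      have "finite {x. \<eta> x \<noteq> 0}"
        using that by (simp add: Cc_def)
      from ex[OF this, of "Suc n"] show ?thesis
        by blast
    qed
  qed
  then obtain \<eta> where good: "\<And>n. ?good n (\<eta> n)"
    and step: "\<And>n x. \<eta> n x \<noteq> 0 \<Longrightarrow> \<eta> (Suc n) x = 1"
    by blast
  show ?thesis
    unfolding complete_graph_def
  proof (intro exI[of _ \<eta>] conjI allI)
    show "incseq \<eta>"
    proof (rule incseq_SucI, rule le_funI)
      show "\<eta> n x \<le> \<eta> (Suc n) x" for n x
        using good[of n] good[of "Suc n"] step[of n x] by (cases "\<eta> n x = 0") auto
    qed
    show "\<eta> k \<in> Cc" "0 \<le> \<eta> k x" for k x
      using good by auto
    \<comment> \<open>The inequality \<open>to_nat x < k\<close> is strict, hence the start at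
      \<open>Suc (to_nat x)\<close>.\<close>
    show "(\<lambda>k. \<eta> k x) \<longlonglongrightarrow> 1" for x
      using good by (intro tendsto_eventually eventually_sequentiallyI[of "Suc (to_nat x)"]) auto
    show "uniform_limit UNIV (\<lambda>k. Gam b m 1 (\<eta> k) (\<eta> k)) (\<lambda>_. 0) sequentially"
    proof (rule uniform_limitI)
      fix e :: real assume e: "0 < e"
      have "\<forall>\<^sub>F n in sequentially. inverse (real (Suc n)) < e"
        by (rule order_tendstoD(2)[OF LIMSEQ_inverse_real_of_nat e])
      then show "\<forall>\<^sub>F n in sequentially. \<forall>x\<in>UNIV. dist (Gam b m 1 (\<eta> n) (\<eta> n) x) 0 < e"
      proof eventually_elim
        case (elim n)
        have "dist (Gam b m 1 (\<eta> n) (\<eta> n) x) 0 \<le> inverse (real (Suc n))" for x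
          using good[of n] Gam_nonneg[of "\<eta> n" x] by (simp add: dist_real_def)
        then show ?case
          using elim by (meson le_less_trans)
      qed
    qed
  qed
qed

end
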